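(* Let $X,Y,Z,M,L,L'$ be objects of $\mathcal C$. The orbit space of $\mathrm{Hom}(M\oplus X,L)^{Y,Z[1]}_{L'[1]}$ under the action of $\mathrm{Aut}\,L$ and the orbit space of $\mathrm{Hom}(L',M\oplus X)^{Y,Z[1]}_{L}$ under the action of $\mathrm{Aut}\,L'$ coincide (the orbits of $\binom{m}{f}$ and of $(f',-m')$ being identified when these morphisms fit into a distinguished triangle $L'\xrightarrow{(f',-m')}M\oplus X\xrightarrow{\binom{m}{f}}L\to L'[1]$). More explicitly, $$\frac{|\mathrm{Hom}(M\oplus X,L)^{Y,Z[1]}_{L'[1]}|}{|\mathrm{Aut}\,L|}\cdot\frac{\{M\oplus X,L\}}{\{L',L\}\{L,L\}}=\frac{|\mathrm{Hom}(L',M\oplus X)^{Y,Z[1]}_{L}|}{|\mathrm{Aut}\,L'|}\cdot\frac{\{L',M\oplus X\}}{\{L',L\}\{L',L'\}}.$$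
   Context: $k$ is a finite field and $\mathcal C$ is a (left) homologically finite $k$-additive triangulated category with shift $[1]$, i.e.: (1) $\mathrm{Hom}(X,Y)$ is a finite-dimensional $k$-space for all $X,Y$; (2) the endomorphism ring of any indecomposable object is a finite-dimensional local $k$-algebra; (3) $\sum_{i\ge 0}\dim_k\mathrm{Hom}(X[i],Y)<\infty$ for all $X,Y$. $|S|$ is the cardinality of a finite set $S$, and $\{X,Y\}:=\prod_{i>0}|\mathrm{Hom}(X[i],Y)|^{(-1)^i}$. Define $$\mathrm{Hom}(M\oplus X,L)^{Y,Z[1]}_{L'[1]}=\Big\{\tbinom{m}{f}\in\mathrm{Hom}(M\oplus X,L)\ \Big|\ \mathrm{Cone}(f)\simeq Y,\ \mathrm{Cone}(m)\simeq Z[1],\ \mathrm{Cone}\tbinom{m}{f}\simeq L'[1]\Big\},$$ with $m:M\to L$, $f:X\to L$, and $$\mathrm{Hom}(L',M\oplus X)^{Y,Z[1]}_{L}=\{(f',-m')\in\mathrm{Hom}(L',M\oplus X)\mid \mathrm{Cone}(f')\simeq Y,\ \mathrm{Cone}(m')\simeq Z[1],\ \mathrm{Cone}(f',-m')\simeq L\},$$ with $f':L'\to M$, $m':L'\to X$. $\mathrm{Aut}\,L$ and $\mathrm{Aut}\,L'$ act by composition. *)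

theory Defs
  imports Complex_Main "HOL-Algebra.Group_Action" "HOL-Algebra.Ideal"
    "Jordan_Normal_Form.Missing_VectorSpace"
begin

section \<open>Linear categories\<close>

text \<open>
  \<open>Mor C X Y\<close> is the \<open>k\<close>-module of morphisms from \<open>X\<close> to \<open>Y\<close>; its \<open>mult\<close> and \<open>one\<close> components
  carry no meaning.  Composition is written \<open>g \<cdot> f\<close> (first \<open>f\<close>, then \<open>g\<close>) and is only
  constrained on composable pairs.
\<close>

record ('k, 'o, 'm) lin_cat =
  Ob :: "'o set"
  Mor :: "'o \<Rightarrow> 'o \<Rightarrow> ('k, 'm) module"
  idm :: "'o \<Rightarrow> 'm"
  cmp :: "'m \<Rightarrow> 'm \<Rightarrow> 'm"  (infixr \<open>\<cdot>\<index>\<close> 75)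

abbreviation Hom :: "('k, 'o, 'm, 'z) lin_cat_scheme \<Rightarrow> 'o \<Rightarrow> 'o \<Rightarrow> 'm set" where
  "Hom C X Y \<equiv> carrier (Mor C X Y)"

locale linear_category =
  fixes K :: "('k, 'q) ring_scheme" and C :: "('k, 'o, 'm, 'z) lin_cat_scheme" (structure)
  assumes Mor_vectorspace: "\<lbrakk>X \<in> Ob C; Y \<in> Ob C\<rbrakk> \<Longrightarrow> vectorspace K (Mor C X Y)"
    and id_closed: "X \<in> Ob C \<Longrightarrow> idm C X \<in> Hom C X X"
    and cmp_closed:
      "\<lbrakk>X \<in> Ob C; Y \<in> Ob C; Z \<in> Ob C; f \<in> Hom C X Y; g \<in> Hom C Y Z\<rbrakk> \<Longrightarrow> g \<cdot> f \<in> Hom C X Z"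
    and id_left: "\<lbrakk>X \<in> Ob C; Y \<in> Ob C; f \<in> Hom C X Y\<rbrakk> \<Longrightarrow> idm C Y \<cdot> f = f"
    and id_right: "\<lbrakk>X \<in> Ob C; Y \<in> Ob C; f \<in> Hom C X Y\<rbrakk> \<Longrightarrow> f \<cdot> idm C X = f"
    and cmp_assoc:
      "\<lbrakk>W \<in> Ob C; X \<in> Ob C; Y \<in> Ob C; Z \<in> Ob C;
        f \<in> Hom C W X; g \<in> Hom C X Y; h \<in> Hom C Y Z\<rbrakk> \<Longrightarrow> (h \<cdot> g) \<cdot> f = h \<cdot> (g \<cdot> f)"
    and cmp_linear_left:
      "\<lbrakk>X \<in> Ob C; Y \<in> Ob C; Z \<in> Ob C; f \<in> Hom C X Y\<rbrakk>
        \<Longrightarrow> (\<lambda>g. g \<cdot> f) \<in> module_hom K (Mor C Y Z) (Mor C X Z)"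
    and cmp_linear_right:
      "\<lbrakk>X \<in> Ob C; Y \<in> Ob C; Z \<in> Ob C; g \<in> Hom C Y Z\<rbrakk>
        \<Longrightarrow> (\<lambda>f. g \<cdot> f) \<in> module_hom K (Mor C X Y) (Mor C X Z)"

definition End_alg :: "('k, 'o, 'm, 'z) lin_cat_scheme \<Rightarrow> 'o \<Rightarrow> ('k, 'm) module" where
  "End_alg C X = (Mor C X X) \<lparr>mult := cmp C, one := idm C X\<rparr>"

abbreviation Aut :: "('k, 'o, 'm, 'z) lin_cat_scheme \<Rightarrow> 'o \<Rightarrow> 'm monoid" where
  "Aut C X \<equiv> units_of (End_alg C X)"

definition is_iso :: "('k, 'o, 'm, 'z) lin_cat_scheme \<Rightarrow> 'o \<Rightarrow> 'o \<Rightarrow> 'm \<Rightarrow> bool" where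
  "is_iso C X Y f \<longleftrightarrow>
     f \<in> Hom C X Y \<and> (\<exists>g \<in> Hom C Y X. cmp C g f = idm C X \<and> cmp C f g = idm C Y)"

definition isomorphic :: "('k, 'o, 'm, 'z) lin_cat_scheme \<Rightarrow> 'o \<Rightarrow> 'o \<Rightarrow> bool" where
  "isomorphic C X Y \<longleftrightarrow> (\<exists>f. is_iso C X Y f)"

definition zero_object :: "('k, 'o, 'm, 'z) lin_cat_scheme \<Rightarrow> 'o \<Rightarrow> bool" where
  "zero_object C N \<longleftrightarrow>
     N \<in> Ob C \<and> (\<forall>X \<in> Ob C. (\<exists>!f. f \<in> Hom C N X) \<and> (\<exists>!f. f \<in> Hom C X N))"

definition is_biproduct ::
  "('k, 'o, 'm, 'z) lin_cat_scheme \<Rightarrow> 'o \<Rightarrow> 'o \<Rightarrow> 'o \<Rightarrow> 'm \<Rightarrow> 'm \<Rightarrow> 'm \<Rightarrow> 'm \<Rightarrow> bool" where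
  "is_biproduct C A B S iA iB pA pB \<longleftrightarrow>
     S \<in> Ob C \<and> iA \<in> Hom C A S \<and> iB \<in> Hom C B S \<and> pA \<in> Hom C S A \<and> pB \<in> Hom C S B \<and>
     cmp C pA iA = idm C A \<and> cmp C pB iB = idm C B \<and>
     cmp C pA iB = \<zero>\<^bsub>Mor C B A\<^esub> \<and> cmp C pB iA = \<zero>\<^bsub>Mor C A B\<^esub> \<and>
     cmp C iA pA \<oplus>\<^bsub>Mor C S S\<^esub> cmp C iB pB = idm C S"

locale additive_linear_category = linear_category +
  assumes zero_object_exists: "\<exists>N. zero_object C N"
    and biproduct_exists:
      "\<lbrakk>A \<in> Ob C; B \<in> Ob C\<rbrakk> \<Longrightarrow> \<exists>S iA iB pA pB. is_biproduct C A B S iA iB pA pB"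

definition indecomposable :: "('k, 'o, 'm, 'z) lin_cat_scheme \<Rightarrow> 'o \<Rightarrow> bool" where
  "indecomposable C X \<longleftrightarrow>
     X \<in> Ob C \<and> \<not> zero_object C X \<and>
     (\<forall>A \<in> Ob C. \<forall>B \<in> Ob C. \<forall>iA iB pA pB.
        is_biproduct C A B X iA iB pA pB \<longrightarrow> zero_object C A \<or> zero_object C B)"

section \<open>Triangulated categories\<close>

text \<open>
  \<open>shO\<close> and \<open>shM\<close> give the shift \<open>[1]\<close> on objects and morphisms; the arguments of
  \<open>distinguished\<close> are the first three objects of \<open>X \<rightarrow> Y \<rightarrow> Z \<rightarrow> X[1]\<close>, then the three maps.
  The shift is required to be an auto-equivalence, so the convention in which it is an
  automorphism is covered.
\<close>

record ('k, 'o, 'm) tri_cat = "('k, 'o, 'm) lin_cat" +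
  shO :: "'o \<Rightarrow> 'o"
  shM :: "'m \<Rightarrow> 'm"
  distinguished :: "'o \<Rightarrow> 'o \<Rightarrow> 'o \<Rightarrow> 'm \<Rightarrow> 'm \<Rightarrow> 'm \<Rightarrow> bool"

locale triangulated_linear_category = additive_linear_category K C
  for K :: "('k, 'q) ring_scheme" and C :: "('k, 'o, 'm, 'z) tri_cat_scheme" (structure) +
  assumes sh_Ob: "X \<in> Ob C \<Longrightarrow> shO C X \<in> Ob C"
    and sh_linear:
      "\<lbrakk>X \<in> Ob C; Y \<in> Ob C\<rbrakk> \<Longrightarrow> shM C \<in> module_hom K (Mor C X Y) (Mor C (shO C X) (shO C Y))"
    and sh_id: "X \<in> Ob C \<Longrightarrow> shM C (idm C X) = idm C (shO C X)"
    and sh_cmp: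
      "\<lbrakk>X \<in> Ob C; Y \<in> Ob C; Z \<in> Ob C; f \<in> Hom C X Y; g \<in> Hom C Y Z\<rbrakk>
        \<Longrightarrow> shM C (g \<cdot> f) = shM C g \<cdot> shM C f"
    and sh_fully_faithful:
      "\<lbrakk>X \<in> Ob C; Y \<in> Ob C\<rbrakk> \<Longrightarrow> bij_betw (shM C) (Hom C X Y) (Hom C (shO C X) (shO C Y))"
    and sh_ess_surj: "Y \<in> Ob C \<Longrightarrow> \<exists>X \<in> Ob C. isomorphic C (shO C X) Y"
    and dist_typed:
      "distinguished C X Y Z u v w \<Longrightarrow>
        X \<in> Ob C \<and> Y \<in> Ob C \<and> Z \<in> Ob C \<and>
        u \<in> Hom C X Y \<and> v \<in> Hom C Y Z \<and> w \<in> Hom C Z (shO C X)"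
    and TR1_iso:
      "\<lbrakk>distinguished C X Y Z u v w; X' \<in> Ob C; Y' \<in> Ob C; Z' \<in> Ob C;
        u' \<in> Hom C X' Y'; v' \<in> Hom C Y' Z'; w' \<in> Hom C Z' (shO C X');
        is_iso C X X' a; is_iso C Y Y' b; is_iso C Z Z' c;
        b \<cdot> u = u' \<cdot> a; c \<cdot> v = v' \<cdot> b; shM C a \<cdot> w = w' \<cdot> c\<rbrakk>
        \<Longrightarrow> distinguished C X' Y' Z' u' v' w'"
    and TR1_id:
      "\<lbrakk>X \<in> Ob C; zero_object C N\<rbrakk>
        \<Longrightarrow> distinguished C X X N (idm C X) \<zero>\<^bsub>Mor C X N\<^esub> \<zero>\<^bsub>Mor C N (shO C X)\<^esub>"
    and TR1_cone:
      "\<lbrakk>X \<in> Ob C; Y \<in> Ob C; u \<in> Hom C X Y\<rbrakk> \<Longrightarrow> \<exists>Z v w. distinguished C X Y Z u v w"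
    and TR2:
      "\<lbrakk>X \<in> Ob C; Y \<in> Ob C; Z \<in> Ob C;
        u \<in> Hom C X Y; v \<in> Hom C Y Z; w \<in> Hom C Z (shO C X)\<rbrakk>
        \<Longrightarrow> distinguished C X Y Z u v w \<longleftrightarrow>
            distinguished C Y Z (shO C X) v w (\<ominus>\<^bsub>Mor C (shO C X) (shO C Y)\<^esub> shM C u)"
    and TR3:
      "\<lbrakk>distinguished C X Y Z u v w; distinguished C X' Y' Z' u' v' w';
        a \<in> Hom C X X'; b \<in> Hom C Y Y'; b \<cdot> u = u' \<cdot> a\<rbrakk>
        \<Longrightarrow> \<exists>c \<in> Hom C Z Z'. c \<cdot> v = v' \<cdot> b \<and> shM C a \<cdot> w = w' \<cdot> c"
    and TR4:
      "\<lbrakk>distinguished C X Y A f f1 f2; distinguished C Y Z B g g1 g2;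
        distinguished C X Z D (g \<cdot> f) h1 h2\<rbrakk>
        \<Longrightarrow> \<exists>u \<in> Hom C A D. \<exists>v \<in> Hom C D B.
              distinguished C A D B u v (shM C f1 \<cdot> g2) \<and>
              u \<cdot> f1 = h1 \<cdot> g \<and> h2 \<cdot> u = f2 \<and> v \<cdot> h1 = g1 \<and> g2 \<cdot> v = shM C f \<cdot> h2"

section \<open>Homological finiteness\<close>

definition left_ideal :: "'a set \<Rightarrow> ('a, 'b) ring_scheme \<Rightarrow> bool" where
  "left_ideal I R \<longleftrightarrow>
     additive_subgroup I R \<and> (\<forall>r \<in> carrier R. \<forall>x \<in> I. r \<otimes>\<^bsub>R\<^esub> x \<in> I)"

definition maximal_left_ideal :: "'a set \<Rightarrow> ('a, 'b) ring_scheme \<Rightarrow> bool" where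
  "maximal_left_ideal I R \<longleftrightarrow>
     left_ideal I R \<and> I \<noteq> carrier R \<and>
     (\<forall>J. left_ideal J R \<and> I \<subseteq> J \<longrightarrow> J = I \<or> J = carrier R)"

text \<open>Not necessarily commutative local rings.\<close>

definition local_ring :: "('a, 'b) ring_scheme \<Rightarrow> bool" where
  "local_ring R \<longleftrightarrow> ring R \<and> (\<exists>!I. maximal_left_ideal I R)"

locale left_homologically_finite_tri_cat = triangulated_linear_category K C
  for K :: "('k, 'q) ring_scheme" and C :: "('k, 'o, 'm, 'z) tri_cat_scheme" (structure) +
  assumes base_field: "field K" and base_finite: "finite (carrier K)"
    and Hom_fin_dim: "\<lbrakk>X \<in> Ob C; Y \<in> Ob C\<rbrakk> \<Longrightarrow> vectorspace.fin_dim K (Mor C X Y)"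
    and End_local:
      "indecomposable C X \<Longrightarrow>
        vectorspace.fin_dim K (End_alg C X) \<and> local_ring (End_alg C X)"
    and left_finite:
      "\<lbrakk>X \<in> Ob C; Y \<in> Ob C\<rbrakk>
        \<Longrightarrow> summable (\<lambda>i. real (vectorspace.dim K (Mor C ((shO C ^^ i) X) Y)))"

text \<open>
  \<open>{X, Y}\<close>, the product over \<open>i > 0\<close> of the factors \<open>|Hom(X[i], Y)|\<close> to the power \<open>(-1)^i\<close>.  By
  left homological finiteness almost all factors are 1; \<open>prod\<close> over an infinite set is 1 by
  convention, hence the restriction to the indices of non-trivial factors.
\<close>

definition brace :: "('k, 'o, 'm, 'z) tri_cat_scheme \<Rightarrow> 'o \<Rightarrow> 'o \<Rightarrow> rat" where
  "brace C X Y =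
     (\<Prod>i \<in> {i. 0 < i \<and> card (Hom C ((shO C ^^ i) X) Y) \<noteq> 1}.
        rat_of_nat (card (Hom C ((shO C ^^ i) X) Y)) powi ((-1) ^ i))"

section \<open>Morphisms from and to a direct sum with prescribed cones\<close>

text \<open>\<open>Cone(u) \<simeq> W\<close> for \<open>u : X \<rightarrow> Y\<close>; cones are unique up to isomorphism.\<close>

definition cone_iso ::
  "('k, 'o, 'm, 'z) tri_cat_scheme \<Rightarrow> 'o \<Rightarrow> 'o \<Rightarrow> 'm \<Rightarrow> 'o \<Rightarrow> bool" where
  "cone_iso C X Y u W \<longleftrightarrow> (\<exists>Z v w. distinguished C X Y Z u v w \<and> isomorphic C Z W)"

text \<open>
  For a direct sum \<open>S\<close> of \<open>M\<close> and \<open>X\<close> with injections \<open>iM\<close>, \<open>iX\<close> and projections \<open>pM\<close>, \<open>pX\<close>: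
  the morphism \<open>S \<rightarrow> L\<close> with components \<open>m : M \<rightarrow> L\<close>, \<open>f : X \<rightarrow> L\<close>, and the morphism \<open>L' \<rightarrow> S\<close>
  with components \<open>f' : L' \<rightarrow> M\<close>, \<open>n : L' \<rightarrow> X\<close>.
\<close>

definition from_sum ::
  "('k, 'o, 'm, 'z) lin_cat_scheme \<Rightarrow> 'o \<Rightarrow> 'm \<Rightarrow> 'm \<Rightarrow> 'o \<Rightarrow> 'm \<Rightarrow> 'm \<Rightarrow> 'm" where
  "from_sum C S pM pX L m f = cmp C m pM \<oplus>\<^bsub>Mor C S L\<^esub> cmp C f pX"

definition to_sum ::
  "('k, 'o, 'm, 'z) lin_cat_scheme \<Rightarrow> 'o \<Rightarrow> 'm \<Rightarrow> 'm \<Rightarrow> 'o \<Rightarrow> 'm \<Rightarrow> 'm \<Rightarrow> 'm" where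
  "to_sum C S iM iX L' f' n = cmp C iM f' \<oplus>\<^bsub>Mor C L' S\<^esub> cmp C iX n"

definition Hom_from_sum ::
  "('k, 'o, 'm, 'z) tri_cat_scheme \<Rightarrow> 'o \<Rightarrow> 'o \<Rightarrow> 'o \<Rightarrow> 'm \<Rightarrow> 'm \<Rightarrow> 'o \<Rightarrow> 'o \<Rightarrow> 'o \<Rightarrow> 'o \<Rightarrow> 'm set" where
  "Hom_from_sum C M X S pM pX L Y Z L' =
     {from_sum C S pM pX L m f | m f. m \<in> Hom C M L \<and> f \<in> Hom C X L \<and>
        cone_iso C X L f Y \<and> cone_iso C M L m (shO C Z) \<and>
        cone_iso C S L (from_sum C S pM pX L m f) (shO C L')}"

definition Hom_to_sum ::
  "('k, 'o, 'm, 'z) tri_cat_scheme \<Rightarrow> 'o \<Rightarrow> 'o \<Rightarrow> 'o \<Rightarrow> 'm \<Rightarrow> 'm \<Rightarrow> 'o \<Rightarrow> 'o \<Rightarrow> 'o \<Rightarrow> 'o \<Rightarrow> 'm set" where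
  "Hom_to_sum C M X S iM iX L' Y Z L =
     {to_sum C S iM iX L' f' (\<ominus>\<^bsub>Mor C L' X\<^esub> m') | f' m'. f' \<in> Hom C L' M \<and> m' \<in> Hom C L' X \<and>
        cone_iso C L' M f' Y \<and> cone_iso C L' X m' (shO C Z) \<and>
        cone_iso C L' S (to_sum C S iM iX L' f' (\<ominus>\<^bsub>Mor C L' X\<^esub> m')) L}"

text \<open>
  The actions of \<open>Aut L\<close> on morphisms into \<open>L\<close> and of \<open>Aut L'\<close> on morphisms out of \<open>L'\<close>; the
  inverse turns precomposition into a left action and does not change the orbits.
\<close>

definition post_act :: "('k, 'o, 'm, 'z) lin_cat_scheme \<Rightarrow> 'm \<Rightarrow> 'm \<Rightarrow> 'm" where
  "post_act C a g = cmp C a g"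

definition pre_act :: "('k, 'o, 'm, 'z) lin_cat_scheme \<Rightarrow> 'o \<Rightarrow> 'm \<Rightarrow> 'm \<Rightarrow> 'm" where
  "pre_act C L' a g = cmp C g (inv\<^bsub>Aut C L'\<^esub> a)"

end

theory Submission
  imports Defs
begin

text \<open>
  Let \<open>L' \<rightarrow> S \<rightarrow> L \<rightarrow> L'[1]\<close> be distinguished with maps \<open>g'\<close>, \<open>g\<close>, \<open>h\<close>.  The octahedral axiom for
  \<open>L' \<rightarrow> S \<rightarrow> M\<close> shows that the two components \<open>L' \<rightarrow> M\<close> and \<open>X \<rightarrow> L\<close> have the same cone, so \<open>g\<close> lies in
  the first set iff \<open>g'\<close> lies in the second; sharing a triangle matches the orbits.  The stabilizer of
  \<open>g\<close> consists of the invertible \<open>1 + ch\<close> and that of \<open>g'\<close>, after a shift, of the invertible \<open>1 + hc\<close>,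
  where \<open>c\<close> ranges over \<open>Hom(L'[1], L)\<close>.  Since \<open>1 + ch\<close> is invertible iff \<open>1 + hc\<close> is, the orders of
  the stabilizers are in the ratio of those of the images of \<open>c \<mapsto> ch\<close> and \<open>c \<mapsto> hc\<close>, and by the long exact
  sequences of \<open>Hom(-, L)\<close> and \<open>Hom(L', -)\<close> these images have order
  \<open>{S, L} / ({L', L} {L, L})\<close> and \<open>{L', S} / ({L', L} {L', L'})\<close>.
\<close>

section \<open>Morphism calculus in linear categories\<close>

text \<open>A cone is determined only up to a non-canonical isomorphism, so sharing a triangle is a
  relation between morphisms and not a map. It becomes a bijection only on orbits, which is why the
  count runs orbit by orbit.

  Corresponding orbits may differ in size; each size is |Aut| / |Stab|. Let U be the set of
  \<open>c\<close> in Hom(L'[1], L) with \<open>1 + ch\<close> invertible. U need not be a subgroup,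
  but it is a union of cosets of the kernel of \<open>c -> ch\<close> and also of the kernel of
  \<open>c -> hc\<close>. The kernel factor cancels on each side and leaves |Stab| / |image| = |U| /
  |Hom(L'[1], L)|, where the right-hand side is common to both.

  The long exact sequences continue indefinitely towards higher shifts in the first argument. Left
  homological finiteness makes Hom(X[i], T) trivial for large \<open>i\<close>, so the order of an
  image is computed by a recursion that ends there, with truncated alternating products. As the
  shift is only an auto-equivalence, nothing is shifted back: preimages of morphisms under the full
  and faithful shift replace negative shifts.\<close>

context linear_category
begin

text \<open>One fact carries all the typing premises: every law of the category is conditional on
  the ends lying in \<open>Ob C\<close>, and an element \<open>f\<close> alone does not determine
  its source and target.\<close>

definition arr where
  "arr f X Y \<longleftrightarrow> X \<in> Ob C \<and> Y \<in> Ob C \<and> f \<in> Hom C X Y"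

abbreviation mzero where "mzero X Y \<equiv> \<zero>\<^bsub>Mor C X Y\<^esub>"
abbreviation madd where "madd X Y f g \<equiv> f \<oplus>\<^bsub>Mor C X Y\<^esub> g"
abbreviation mneg where "mneg X Y f \<equiv> \<ominus>\<^bsub>Mor C X Y\<^esub> f"

lemma arrI: "X \<in> Ob C \<Longrightarrow> Y \<in> Ob C \<Longrightarrow> f \<in> Hom C X Y \<Longrightarrow> arr f X Y"
  by (simp add: arr_def)

lemma arr_dom: "arr f X Y \<Longrightarrow> X \<in> Ob C"
  and arr_cod: "arr f X Y \<Longrightarrow> Y \<in> Ob C"
  and arr_Hom: "arr f X Y \<Longrightarrow> f \<in> Hom C X Y"
  by (simp_all add: arr_def)

lemma Mor_module: "X \<in> Ob C \<Longrightarrow> Y \<in> Ob C \<Longrightarrow> module K (Mor C X Y)"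
  using Mor_vectorspace by (simp add: vectorspace_def)

lemma Mor_abelian_group: "X \<in> Ob C \<Longrightarrow> Y \<in> Ob C \<Longrightarrow> abelian_group (Mor C X Y)"
  using Mor_module by (simp add: module_def)

lemma arr_cmp: "arr f X Y \<Longrightarrow> arr g Y Z \<Longrightarrow> arr (g \<cdot> f) X Z"
  using cmp_closed[of X Y Z f g] by (simp add: arr_def)

lemma arr_id: "X \<in> Ob C \<Longrightarrow> arr (idm C X) X X"
  using id_closed by (simp add: arr_def)

lemma arr_mzero: "X \<in> Ob C \<Longrightarrow> Y \<in> Ob C \<Longrightarrow> arr (mzero X Y) X Y"
  by (simp add: arr_def Mor_abelian_group abelian_group.axioms(1) abelian_monoid.zero_closed)

lemma arr_plus: "arr f X Y \<Longrightarrow> arr g X Y \<Longrightarrow> arr (madd X Y f g) X Y"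
  by (simp add: arr_def Mor_abelian_group abelian_group.axioms(1) abelian_monoid.a_closed)

lemma arr_neg: "arr f X Y \<Longrightarrow> arr (mneg X Y f) X Y"
  by (simp add: arr_def Mor_abelian_group abelian_group.a_inv_closed)

lemma cmp_idl: "arr f X Y \<Longrightarrow> idm C Y \<cdot> f = f"
  and cmp_idr: "arr f X Y \<Longrightarrow> f \<cdot> idm C X = f"
  using id_left id_right by (auto simp: arr_def)

lemma cmp_assoc_arr: "arr f W X \<Longrightarrow> arr g X Y \<Longrightarrow> arr h Y Z \<Longrightarrow> (h \<cdot> g) \<cdot> f = h \<cdot> (g \<cdot> f)"
  using cmp_assoc[of W X Y Z f g h] by (simp add: arr_def)

lemma cmp_plus_left:
  "arr f X Y \<Longrightarrow> arr g Y Z \<Longrightarrow> arr g' Y Z \<Longrightarrow> madd Y Z g g' \<cdot> f = madd X Z (g \<cdot> f) (g' \<cdot> f)"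
  using module_hom_add[OF cmp_linear_left] by (simp add: arr_def)

lemma cmp_plus_right:
  "arr f X Y \<Longrightarrow> arr f' X Y \<Longrightarrow> arr g Y Z \<Longrightarrow> g \<cdot> madd X Y f f' = madd X Z (g \<cdot> f) (g \<cdot> f')"
  using module_hom_add[OF cmp_linear_right] by (simp add: arr_def)

lemma plus_mzero:
  assumes "arr f X Y"
  shows "madd X Y f (mzero X Y) = f" "madd X Y (mzero X Y) f = f"
  using assms Mor_abelian_group[of X Y]
  by (simp_all add: arr_def abelian_group.axioms(1) abelian_monoid.r_zero abelian_monoid.l_zero)

lemma plus_neg:
  assumes "arr f X Y"
  shows "madd X Y f (mneg X Y f) = mzero X Y" "madd X Y (mneg X Y f) f = mzero X Y"
  using assms Mor_abelian_group[of X Y]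
  by (simp_all add: arr_def abelian_group.r_neg abelian_group.l_neg)

lemma plus_assoc:
  "arr f X Y \<Longrightarrow> arr g X Y \<Longrightarrow> arr h X Y \<Longrightarrow> madd X Y (madd X Y f g) h = madd X Y f (madd X Y g h)"
  using Mor_abelian_group[of X Y]
  by (simp add: arr_def abelian_group.axioms(1) abelian_monoid.a_assoc)

lemma plus_comm: "arr f X Y \<Longrightarrow> arr g X Y \<Longrightarrow> madd X Y f g = madd X Y g f"
  using Mor_abelian_group[of X Y]
  by (simp add: arr_def abelian_group.axioms(1) abelian_monoid.a_comm)

lemma neg_neg: "arr f X Y \<Longrightarrow> mneg X Y (mneg X Y f) = f"
  using Mor_abelian_group[of X Y] by (simp add: arr_def abelian_group.minus_minus)

lemma plus_eq_mzeroD: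
  assumes f: "arr f X Y" and g: "arr g X Y" and "madd X Y f g = mzero X Y"
  shows "g = mneg X Y f"
  using plus_assoc[OF arr_neg[OF f] f g] plus_neg[OF f] plus_mzero[OF g] plus_mzero[OF arr_neg[OF f]] assms(3)
  by simp

lemma neg_mzero: "X \<in> Ob C \<Longrightarrow> Y \<in> Ob C \<Longrightarrow> mneg X Y (mzero X Y) = mzero X Y"
  using plus_eq_mzeroD[OF arr_mzero arr_mzero plus_mzero(1)[OF arr_mzero]] by simp

lemma plus_diff_cancel:
  assumes f: "arr f X Y" and g: "arr g X Y"
  shows "madd X Y (madd X Y f g) (mneg X Y g) = f" "madd X Y g (madd X Y f (mneg X Y g)) = f"
proof -
  note g' = arr_neg[OF g]
  show *: "madd X Y (madd X Y f g) (mneg X Y g) = f"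
    by (simp only: plus_assoc[OF f g g'] plus_neg[OF g] plus_mzero[OF f])
  show "madd X Y g (madd X Y f (mneg X Y g)) = f"
    by (simp only: plus_comm[OF g arr_plus[OF f g']] plus_assoc[OF f g' g] plus_neg[OF g] plus_mzero[OF f])
qed

text \<open>An additive map sends zero to such an \<open>f\<close>; this yields the laws for
  composing with zero and for shifting it.\<close>

lemma plus_idem_mzero:
  assumes f: "arr f X Y" and "madd X Y f f = f"
  shows "f = mzero X Y"
  using plus_diff_cancel(1)[OF f f] assms(2) plus_neg(1)[OF f] by simp

lemma cmp_mzero_left:
  assumes f: "arr f X Y" and Z: "Z \<in> Ob C"
  shows "mzero Y Z \<cdot> f = mzero X Z"
proof -
  note 0 = arr_mzero[OF arr_cod[OF f] Z]
  show ?thesis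
    using plus_idem_mzero[OF arr_cmp[OF f 0]] cmp_plus_left[OF f 0 0] plus_mzero(1)[OF 0] by simp
qed

lemma cmp_mzero_right:
  assumes g: "arr g Y Z" and X: "X \<in> Ob C"
  shows "g \<cdot> mzero X Y = mzero X Z"
proof -
  note 0 = arr_mzero[OF X arr_dom[OF g]]
  show ?thesis
    using plus_idem_mzero[OF arr_cmp[OF 0 g]] cmp_plus_right[OF 0 0 g] plus_mzero(1)[OF 0] by simp
qed

lemma cmp_neg_left:
  assumes "arr f X Y" "arr g Y Z"
  shows "mneg Y Z g \<cdot> f = mneg X Z (g \<cdot> f)"
proof -
  have "madd X Z (g \<cdot> f) (mneg Y Z g \<cdot> f) = mzero X Z"
    using cmp_plus_left[OF assms arr_neg[OF assms(2)]] plus_neg(1)[OF assms(2)]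
      cmp_mzero_left[OF assms(1) arr_cod[OF assms(2)]] by simp
  then show ?thesis
    by (rule plus_eq_mzeroD[OF arr_cmp[OF assms] arr_cmp[OF assms(1) arr_neg[OF assms(2)]]])
qed

lemma cmp_neg_right:
  assumes "arr f X Y" "arr g Y Z"
  shows "g \<cdot> mneg X Y f = mneg X Z (g \<cdot> f)"
proof -
  have "madd X Z (g \<cdot> f) (g \<cdot> mneg X Y f) = mzero X Z"
    using cmp_plus_right[OF assms(1) arr_neg[OF assms(1)] assms(2)] plus_neg(1)[OF assms(1)]
      cmp_mzero_right[OF assms(2) arr_dom[OF assms(1)]] by simp
  then show ?thesis
    by (rule plus_eq_mzeroD[OF arr_cmp[OF assms] arr_cmp[OF arr_neg[OF assms(1)] assms(2)]])
qed

section \<open>Isomorphisms and invertible endomorphisms\<close>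

definition iso where
  "iso f X Y \<longleftrightarrow> X \<in> Ob C \<and> Y \<in> Ob C \<and> is_iso C X Y f"

lemma iso_iff:
  "iso f X Y \<longleftrightarrow> arr f X Y \<and> (\<exists>g. arr g Y X \<and> g \<cdot> f = idm C X \<and> f \<cdot> g = idm C Y)"
  unfolding iso_def is_iso_def arr_def by auto

lemma iso_arr: "iso f X Y \<Longrightarrow> arr f X Y"
  by (simp add: iso_iff)

lemma isoI:
  "arr f X Y \<Longrightarrow> arr g Y X \<Longrightarrow> g \<cdot> f = idm C X \<Longrightarrow> f \<cdot> g = idm C Y \<Longrightarrow> iso f X Y"
  by (auto simp: iso_iff)

lemma iso_id: "X \<in> Ob C \<Longrightarrow> iso (idm C X) X X"
  by (meson arr_id cmp_idr isoI)

lemma iso_inverse: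
  assumes "iso f X Y"
  obtains g where "iso g Y X" "g \<cdot> f = idm C X" "f \<cdot> g = idm C Y"
  using assms by (metis iso_iff)

lemma cmp_cancel_left:
  assumes "arr f W X" "arr g X Y" "arr g' Y X" "g' \<cdot> g = idm C X"
  shows "g' \<cdot> (g \<cdot> f) = f"
  using cmp_assoc_arr[OF assms(1,2,3)] assms(1,4) by (simp add: cmp_idl)

lemma iso_cmp:
  assumes "iso f X Y" "iso g Y Z"
  shows "iso (g \<cdot> f) X Z"
proof -
  obtain f' where f: "arr f X Y" "arr f' Y X" "f' \<cdot> f = idm C X" "f \<cdot> f' = idm C Y"
    using assms by (auto simp: iso_iff)
  obtain g' where g: "arr g Y Z" "arr g' Z Y" "g' \<cdot> g = idm C Y" "g \<cdot> g' = idm C Z"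
    using assms by (auto simp: iso_iff)
  have "(f' \<cdot> g') \<cdot> (g \<cdot> f) = idm C X"
    using f g arr_cmp[OF f(1) g(1)]
    by (simp add: cmp_assoc_arr[of "g \<cdot> f" X Z g' Y f' X] cmp_cancel_left[of f X Y g Z g'])
  moreover have "(g \<cdot> f) \<cdot> (f' \<cdot> g') = idm C Z"
    using f g arr_cmp[OF g(2) f(2)]
    by (simp add: cmp_assoc_arr[of "f' \<cdot> g'" Z X f Y g Z] cmp_cancel_left[of g' Z Y f' X f])
  ultimately show ?thesis
    using f g by (meson arr_cmp isoI)
qed

lemma iso_if_left_right_inverse:
  assumes "arr f X Y" "arr g Y X" "arr g' Y X" "g \<cdot> f = idm C X" "f \<cdot> g' = idm C Y"
  shows "iso f X Y"
proof -
  have "g = g'"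
    using cmp_cancel_left[OF assms(3,1,2,4)] assms(2,5) by (simp add: cmp_idr)
  then show ?thesis using assms isoI by blast
qed

lemma iso_neg:
  assumes "iso f X Y"
  shows "iso (mneg X Y f) X Y"
proof -
  obtain g where g: "arr f X Y" "arr g Y X" "g \<cdot> f = idm C X" "f \<cdot> g = idm C Y"
    using assms by (auto simp: iso_iff)
  have "mneg Y X g \<cdot> mneg X Y f = idm C X"
    using cmp_neg_left[OF arr_neg[OF g(1)] g(2)] cmp_neg_right[OF g(1,2)] neg_neg[OF arr_cmp[OF g(1,2)]] g(3)
    by simp
  moreover have "mneg X Y f \<cdot> mneg Y X g = idm C Y"
    using cmp_neg_left[OF arr_neg[OF g(2)] g(1)] cmp_neg_right[OF g(2,1)] neg_neg[OF arr_cmp[OF g(2,1)]] g(4)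
    by simp
  ultimately show ?thesis
    using g by (meson arr_neg isoI)
qed

text \<open>Jacobson's lemma, between the endomorphism rings of two objects: if \<open>u\<close>
  inverts \<open>1 + ch\<close>, then \<open>1 - huc\<close> inverts \<open>1 + hc\<close>. It lets
  both stabilizers be indexed by one and the same set of \<open>c\<close>.\<close>

lemma iso_one_plus_swap:
  assumes h: "arr h X Y" and c: "arr c Y X"
    and i: "iso (madd X X (idm C X) (c \<cdot> h)) X X"
  shows "iso (madd Y Y (idm C Y) (h \<cdot> c)) Y Y"
proof -
  let ?p = "madd X X (idm C X) (c \<cdot> h)" and ?q = "madd Y Y (idm C Y) (h \<cdot> c)"
  obtain u where u: "arr u X X" "u \<cdot> ?p = idm C X" "?p \<cdot> u = idm C X"
    using i by (auto simp: iso_iff)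
  have X: "X \<in> Ob C" and Y: "Y \<in> Ob C"
    using h by (auto dest: arr_dom arr_cod)
  have ch: "arr (c \<cdot> h) X X" and hc: "arr (h \<cdot> c) Y Y"
    using h c by (meson arr_cmp)+
  have arrs: "arr ?p X X" "arr ?q Y Y"
    using X Y ch hc by (meson arr_id arr_plus)+
  let ?w = "h \<cdot> u \<cdot> c"
  have w: "arr ?w Y Y" "arr (h \<cdot> u) X Y" "arr (u \<cdot> c) Y X"
    using h c u by (meson arr_cmp)+
  let ?v = "madd Y Y (idm C Y) (mneg Y Y ?w)"
  have v: "arr ?v Y Y"
    using w Y by (meson arr_id arr_neg arr_plus)
  \<comment> \<open>From \<open>(1 + hc)h = h(1 + ch)\<close> the factor \<open>1 + hc\<close> moves
    past \<open>h\<close> and cancels against \<open>u\<close>.\<close>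
  have 1: "?q \<cdot> ?w = h \<cdot> c"
  proof -
    have "?q \<cdot> h = h \<cdot> ?p"
      using h c X Y ch hc
      by (simp add: cmp_plus_left[of h X Y _ Y] cmp_plus_right[of _ X X _ h Y] arr_id cmp_idl cmp_idr
          cmp_assoc_arr[of h X Y c X h Y])
    then show ?thesis
      using cmp_assoc_arr[OF w(3) h arrs(2)] cmp_assoc_arr[OF w(3) arrs(1) h]
        cmp_cancel_left[OF c u(1) arrs(1) u(3)] by simp
  qed
  have 2: "?w \<cdot> ?q = h \<cdot> c"
  proof -
    have "c \<cdot> ?q = ?p \<cdot> c"
      using h c X Y ch hc
      by (simp add: cmp_plus_left[of c Y X _ X] cmp_plus_right[of _ Y Y _ c X] arr_id cmp_idl cmp_idr
          cmp_assoc_arr[of c Y X h Y c X])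
    then have "(u \<cdot> c) \<cdot> ?q = c"
      using cmp_assoc_arr[OF arrs(2) c u(1)] cmp_cancel_left[OF c arrs(1) u(1) u(2)] by simp
    then show ?thesis
      using cmp_assoc_arr[OF arrs(2) w(3) h] by simp
  qed
  have 3: "madd Y Y ?q (mneg Y Y (h \<cdot> c)) = idm C Y"
    using plus_diff_cancel(1)[OF arr_id[OF Y] hc] .
  have "?q \<cdot> ?v = idm C Y"
    using cmp_plus_right[of "idm C Y" Y Y "mneg Y Y ?w" ?q Y] cmp_neg_right[OF w(1) arrs(2)]
      1 3 arrs Y w by (simp add: arr_id arr_neg cmp_idr)
  moreover have "?v \<cdot> ?q = idm C Y"
    using cmp_plus_left[of ?q Y Y "idm C Y" Y "mneg Y Y ?w"] cmp_neg_left[OF arrs(2) w(1)]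
      2 3 arrs Y w by (simp add: arr_id arr_neg cmp_idl)
  ultimately show ?thesis
    using arrs v isoI by blast
qed

text \<open>The geometric series for the inverse stops at \<open>1 - e\<close>.\<close>

lemma iso_one_plus_square_zero:
  assumes e: "arr e X X" and sq: "e \<cdot> e = mzero X X"
  shows "iso (madd X X (idm C X) e) X X"
proof -
  let ?x = "madd X X (idm C X) e" and ?y = "madd X X (idm C X) (mneg X X e)"
  have id: "arr (idm C X) X X"
    using e by (rule arr_id[OF arr_dom])
  have x: "arr ?x X X" and y: "arr ?y X X"
    using id e by (meson arr_neg arr_plus)+
  have "?x \<cdot> e = e" "e \<cdot> ?x = e"
    using id e sq
    by (simp_all add: cmp_plus_left[of e X X _ X] cmp_plus_right[of _ X X _ e X] cmp_idl cmp_idr plus_mzero)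
  then have "?y \<cdot> ?x = idm C X" "?x \<cdot> ?y = idm C X"
    using x id e
    by (simp_all add: cmp_plus_left[of ?x X X _ X] cmp_plus_right[of _ X X _ ?x X] arr_neg
        cmp_neg_left[of ?x X X e X] cmp_neg_right[of e X X ?x X] cmp_idl cmp_idr plus_diff_cancel)
  then show ?thesis
    using x y isoI by blast
qed

lemma unipotent_iso:
  assumes x: "arr x X X"
    and sq: "madd X X x (mneg X X (idm C X)) \<cdot> madd X X x (mneg X X (idm C X)) = mzero X X"
  shows "iso x X X"
proof -
  have id: "arr (idm C X) X X"
    using x by (rule arr_id[OF arr_dom])
  then show ?thesis
    using iso_one_plus_square_zero[OF arr_plus[OF x arr_neg[OF id]] sq]
    by (simp only: plus_diff_cancel(2)[OF x id])
qed

lemma isomorphic_iff: "X \<in> Ob C \<Longrightarrow> Y \<in> Ob C \<Longrightarrow> isomorphic C X Y \<longleftrightarrow> (\<exists>f. iso f X Y)"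
  by (simp add: isomorphic_def iso_def)

end

section \<open>Distinguished triangles and cones\<close>

context triangulated_linear_category
begin

lemma arr_sh: "arr f X Y \<Longrightarrow> arr (shM C f) (shO C X) (shO C Y)"
  using sh_fully_faithful[of X Y] sh_Ob unfolding arr_def bij_betw_def by blast

lemma sh_cmp_arr: "arr f X Y \<Longrightarrow> arr g Y Z \<Longrightarrow> shM C (g \<cdot> f) = shM C g \<cdot> shM C f"
  using sh_cmp[of X Y Z f g] by (simp add: arr_def)

lemma sh_plus:
  assumes "arr f X Y" "arr g X Y"
  shows "shM C (madd X Y f g) = madd (shO C X) (shO C Y) (shM C f) (shM C g)"
  by (rule module_hom_add[OF sh_linear[OF arr_dom[OF assms(1)] arr_cod[OF assms(1)]] arr_Hom[OF assms(1)] arr_Hom[OF assms(2)]])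

lemma sh_mzero:
  assumes X: "X \<in> Ob C" and Y: "Y \<in> Ob C"
  shows "shM C (mzero X Y) = mzero (shO C X) (shO C Y)"
  by (rule plus_idem_mzero[OF arr_sh[OF arr_mzero[OF X Y]]])
    (simp only: sh_plus[OF arr_mzero[OF X Y] arr_mzero[OF X Y], symmetric] plus_mzero(1)[OF arr_mzero[OF X Y]])

lemma sh_full:
  assumes X: "X \<in> Ob C" and Y: "Y \<in> Ob C" and g: "arr g (shO C X) (shO C Y)"
  obtains f where "arr f X Y" "shM C f = g"
proof -
  have "g \<in> shM C ` Hom C X Y"
    using bij_betw_imp_surj_on[OF sh_fully_faithful[OF X Y]] arr_Hom[OF g] by simp
  then obtain f where "f \<in> Hom C X Y" "g = shM C f"
    by (rule imageE)
  then show thesis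
    using that[OF arrI[OF X Y]] by blast
qed

lemma sh_inj:
  assumes f: "arr f X Y" and g: "arr g X Y" and "shM C f = shM C g"
  shows "f = g"
  using inj_onD[OF bij_betw_imp_inj_on[OF sh_fully_faithful[OF arr_dom[OF f] arr_cod[OF f]]]
      assms(3) arr_Hom[OF f] arr_Hom[OF g]] .

lemma sh_iso:
  assumes "iso f X Y"
  shows "iso (shM C f) (shO C X) (shO C Y)"
proof -
  obtain g where fg: "arr f X Y" "arr g Y X" "g \<cdot> f = idm C X" "f \<cdot> g = idm C Y"
    using assms by (auto simp: iso_iff)
  then have "shM C g \<cdot> shM C f = idm C (shO C X)" "shM C f \<cdot> shM C g = idm C (shO C Y)"
    using sh_cmp_arr[OF fg(1,2)] sh_cmp_arr[OF fg(2,1)] sh_id[OF arr_dom[OF fg(1)]] sh_id[OF arr_dom[OF fg(2)]]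
    by simp_all
  then show ?thesis
    using isoI arr_sh fg by blast
qed

lemma iso_if_sh_iso:
  assumes f: "arr f X Y" and "iso (shM C f) (shO C X) (shO C Y)"
  shows "iso f X Y"
proof -
  obtain h where h: "arr h (shO C Y) (shO C X)" "h \<cdot> shM C f = idm C (shO C X)" "shM C f \<cdot> h = idm C (shO C Y)"
    using assms by (auto simp: iso_iff)
  have X: "X \<in> Ob C" and Y: "Y \<in> Ob C"
    using f by (rule arr_dom, rule arr_cod)
  obtain g where g: "arr g Y X" "shM C g = h"
    using sh_full[OF Y X h(1)] .
  have "g \<cdot> f = idm C X"
    using sh_inj[OF arr_cmp[OF f g(1)] arr_id[OF X]] sh_cmp_arr[OF f g(1)] g(2) h(2) sh_id[OF X] by simp
  moreover have "f \<cdot> g = idm C Y"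
    using sh_inj[OF arr_cmp[OF g(1) f] arr_id[OF Y]] sh_cmp_arr[OF g(1) f] g(2) h(3) sh_id[OF Y] by simp
  ultimately show ?thesis
    using isoI f g(1) by blast
qed

abbreviation dist where "dist \<equiv> distinguished C"

lemma dist_arr:
  assumes "dist X Y Z u v w"
  shows "arr u X Y" "arr v Y Z" "arr w Z (shO C X)"
  using dist_typed[OF assms] sh_Ob by (auto simp: arr_def)

lemma dist_Ob:
  assumes "dist X Y Z u v w"
  shows "X \<in> Ob C" "Y \<in> Ob C" "Z \<in> Ob C"
  using dist_typed[OF assms] by auto

lemma dist_rotate_iff:
  assumes "arr u X Y" "arr v Y Z" "arr w Z (shO C X)"
  shows "dist X Y Z u v w \<longleftrightarrow>
    dist Y Z (shO C X) v w (mneg (shO C X) (shO C Y) (shM C u))"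
  using TR2[of X Y Z u v w] assms by (simp add: arr_def)

lemma dist_rotate:
  assumes "dist X Y Z u v w"
  shows "dist Y Z (shO C X) v w (mneg (shO C X) (shO C Y) (shM C u))"
  using assms dist_rotate_iff[OF dist_arr[OF assms]] by simp

text \<open>\<open>TR3\<close> maps the triangle \<open>X -> X -> 0\<close> to the given one, with
  \<open>u\<close> in the middle; so \<open>vu\<close> factors through a zero object.\<close>

lemma dist_cmp_zero1:
  assumes d: "dist X Y Z u v w"
  shows "v \<cdot> u = mzero X Z"
proof -
  note [simp] = dist_Ob[OF d]
  note u = dist_arr(1)[OF d]
  obtain N where N: "zero_object C N"
    using zero_object_exists by blast
  then have "N \<in> Ob C"
    by (simp add: zero_object_def)
  obtain c where c: "c \<in> Hom C N Z" "c \<cdot> mzero X N = v \<cdot> u"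
    using TR3[OF TR1_id[OF _ N] d, of X "idm C X" u]
      arr_Hom[OF arr_id] arr_Hom[OF u] cmp_idr[OF u] by auto
  then show ?thesis
    using cmp_mzero_right[of c N Z X] \<open>N \<in> Ob C\<close> by (simp add: arr_def)
qed

lemma dist_cmp_zero2: "dist X Y Z u v w \<Longrightarrow> w \<cdot> v = mzero Y (shO C X)"
  by (rule dist_cmp_zero1[OF dist_rotate])

lemma neg_eq_mzeroD: "arr f X Y \<Longrightarrow> mneg X Y f = mzero X Y \<Longrightarrow> f = mzero X Y"
  using neg_neg[of f X Y] neg_mzero[of X Y] by (simp add: arr_def)

lemma neg_inj:
  assumes "arr f X Y" "arr g X Y" "mneg X Y f = mneg X Y g"
  shows "f = g"
proof -
  have "mneg X Y (mneg X Y f) = mneg X Y (mneg X Y g)"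
    by (simp only: assms(3))
  then show ?thesis
    by (simp only: neg_neg[OF assms(1)] neg_neg[OF assms(2)])
qed

lemma dist_cmp_zero3:
  assumes d: "dist X Y Z u v w"
  shows "shM C u \<cdot> w = mzero Z (shO C Y)"
  using dist_cmp_zero2[OF dist_rotate[OF d]] dist_arr[OF d]
    cmp_neg_left[OF dist_arr(3)[OF d] arr_sh[OF dist_arr(1)[OF d]]]
    neg_eq_mzeroD[OF arr_cmp[OF dist_arr(3)[OF d] arr_sh[OF dist_arr(1)[OF d]]]] by simp

lemma zero_object_iff:
  assumes N: "N \<in> Ob C"
  shows "zero_object C N \<longleftrightarrow> idm C N = mzero N N"
proof
  assume "zero_object C N"
  then show "idm C N = mzero N N"
    using N arr_Hom[OF arr_id[OF N]] arr_Hom[OF arr_mzero[OF N N]] unfolding zero_object_def by blast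
next
  assume id: "idm C N = mzero N N"
  have "f = mzero N X" if "arr f N X" for f X
    using cmp_idr[OF that] cmp_mzero_right[OF that N] id by simp
  moreover have "f = mzero X N" if "arr f X N" for f X
    using cmp_idl[OF that] cmp_mzero_left[OF that N] id by simp
  ultimately show "zero_object C N"
    using N arr_Hom[OF arr_mzero] unfolding zero_object_def
    by (metis arrI)
qed

lemma zero_object_sh:
  assumes "zero_object C N"
  shows "zero_object C (shO C N)"
proof -
  have N: "N \<in> Ob C" using assms by (simp add: zero_object_def)
  show ?thesis
    using assms zero_object_iff[OF N] zero_object_iff[OF sh_Ob[OF N]] sh_id[OF N] sh_mzero[OF N N] by simp
qed

section \<open>Exactness of Hom along a distinguished triangle\<close>

text \<open>\<open>TR3\<close> completes \<open>g\<close> and a zero map to a morphism from the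
  triangle \<open>T -> 0 -> T[1]\<close> to the rotated triangle. Its last component
  \<open>T[1] -> X[1]\<close> is the shift of the wanted \<open>a\<close>, since the shift is
  full.\<close>

lemma dist_exact_cov1:
  assumes d: "dist X Y Z u v w" and g: "arr g T Y" and 0: "v \<cdot> g = mzero T Z"
  obtains a where "arr a T X" "u \<cdot> a = g"
proof -
  note u = dist_arr(1)[OF d]
  have T: "T \<in> Ob C" using g by (rule arr_dom)
  note ObXYZ = dist_Ob[OF d]
  obtain N where N: "zero_object C N"
    using zero_object_exists by blast
  then have NO: "N \<in> Ob C"
    by (simp add: zero_object_def)
  note dT = dist_rotate[OF TR1_id[OF T N]]
  have "mzero N Z \<cdot> mzero T N = v \<cdot> g"
    using 0 cmp_mzero_left[OF arr_mzero[OF T NO] ObXYZ(3)] by simp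
  then obtain c where c: "c \<in> Hom C (shO C T) (shO C X)"
    and eq: "shM C g \<cdot> mneg (shO C T) (shO C T) (shM C (idm C T)) = mneg (shO C X) (shO C Y) (shM C u) \<cdot> c"
    using TR3[OF dT dist_rotate[OF d] arr_Hom[OF g] arr_Hom[OF arr_mzero[OF NO ObXYZ(3)]]] by blast
  have c': "arr c (shO C T) (shO C X)"
    using c sh_Ob T ObXYZ by (simp add: arr_def)
  obtain a where a: "arr a T X" "shM C a = c"
    using sh_full[OF T ObXYZ(1) c'] .
  note sg = arr_sh[OF g] and su = arr_sh[OF u] and iT = arr_id[OF sh_Ob[OF T]]
  \<comment> \<open>Both triangles have been rotated, so both sides carry the same sign and it
    cancels.\<close>
  have "mneg (shO C T) (shO C Y) (shM C g) = mneg (shO C T) (shO C Y) (shM C u \<cdot> c)"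
    using eq sh_id[OF T] cmp_neg_left[OF c' su] cmp_neg_right[OF iT sg] cmp_idr[OF sg] by simp
  then have "shM C g = shM C u \<cdot> c"
    by (rule neg_inj[OF sg arr_cmp[OF c' su]])
  then have "u \<cdot> a = g"
    using sh_inj[OF arr_cmp[OF a(1) u] g] sh_cmp_arr[OF a(1) u] a(2) by simp
  then show thesis
    using that a(1) by blast
qed

lemma dist_exact_cov2:
  assumes "dist X Y Z u v w" "arr g T Z" "w \<cdot> g = mzero T (shO C X)"
  obtains a where "arr a T Y" "v \<cdot> a = g"
  using dist_exact_cov1[OF dist_rotate[OF assms(1)] assms(2,3)] .

lemma dist_exact_cov3:
  assumes d: "dist X Y Z u v w" and g: "arr g T (shO C X)" and 0: "shM C u \<cdot> g = mzero T (shO C Y)"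
  obtains a where "arr a T Z" "w \<cdot> a = g"
proof -
  note su = arr_sh[OF dist_arr(1)[OF d]]
  have "mneg (shO C X) (shO C Y) (shM C u) \<cdot> g = mzero T (shO C Y)"
    using cmp_neg_left[OF g su] 0 neg_mzero[OF arr_dom[OF g] arr_cod[OF su]] by simp
  then show thesis
    using dist_exact_cov2[OF dist_rotate[OF d] g] that by blast
qed

lemma dist_exact_con1:
  assumes d: "dist X Y Z u v w" and g: "arr g Y T" and 0: "g \<cdot> u = mzero X T"
  obtains c where "arr c Z T" "c \<cdot> v = g"
proof -
  have T: "T \<in> Ob C" using g by (rule arr_cod)
  note X = dist_Ob(1)[OF d]
  obtain N where N: "zero_object C N"
    using zero_object_exists by blast
  then have NO: "N \<in> Ob C"
    by (simp add: zero_object_def)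
  have "mneg (shO C N) (shO C T) (shM C (mzero N T)) = mzero (shO C N) (shO C T)"
    using sh_mzero[OF NO T] neg_mzero[OF sh_Ob[OF NO] sh_Ob[OF T]] by simp
  \<comment> \<open>The triangle \<open>0 -> T -> T\<close> is found by rotating backwards: the
    shift of a zero object is a zero object, so its rotation is an instance of
    \<open>TR1_id\<close>.\<close>
  then have dT: "dist N T T (mzero N T) (idm C T) (mzero T (shO C N))"
    using dist_rotate_iff[OF arr_mzero[OF NO T] arr_id[OF T] arr_mzero[OF T sh_Ob[OF NO]]]
      TR1_id[OF T zero_object_sh[OF N]] by simp
  have "g \<cdot> u = mzero N T \<cdot> mzero X N"
    using 0 cmp_mzero_left[OF arr_mzero[OF X NO] T] by simp
  then obtain c where c: "c \<in> Hom C Z T" "c \<cdot> v = idm C T \<cdot> g"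
    using TR3[OF d dT arr_Hom[OF arr_mzero[OF X NO]] arr_Hom[OF g]] by blast
  have "arr c Z T"
    using c dist_Ob[OF d] T by (simp add: arr_def)
  then show thesis
    using that c(2) cmp_idl[OF g] by simp
qed

lemma dist_exact_con2:
  assumes "dist X Y Z u v w" "arr g Z T" "g \<cdot> v = mzero Y T"
  obtains c where "arr c (shO C X) T" "c \<cdot> w = g"
  using dist_exact_con1[OF dist_rotate[OF assms(1)] assms(2,3)] .

section \<open>Morphisms of triangles and uniqueness of cones\<close>

text \<open>Since \<open>p - 1\<close> kills \<open>v\<close>, it factors as \<open>tw\<close>;
  since \<open>w\<close> kills \<open>p - 1\<close>, the square \<open>tw(p - 1)\<close> vanishes.
  Thus \<open>p\<close> is unipotent. This takes the place of the five lemma.\<close>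

lemma dist_endo_iso:
  assumes d: "dist X Y Z u v w" and p: "arr p Z Z" and pv: "p \<cdot> v = v" and wp: "w \<cdot> p = w"
  shows "iso p Z Z"
proof -
  note v = dist_arr(2)[OF d] and w = dist_arr(3)[OF d] and id = arr_id[OF dist_Ob(3)[OF d]]
  let ?e = "madd Z Z p (mneg Z Z (idm C Z))"
  have e: "arr ?e Z Z"
    using p id by (rule arr_plus[OF _ arr_neg])
  have "?e \<cdot> v = mzero Y Z"
    by (simp only: cmp_plus_left[OF v p arr_neg[OF id]] cmp_neg_left[OF v id] cmp_idl[OF v] pv plus_neg(1)[OF v])
  then obtain t where t: "arr t (shO C X) Z" "t \<cdot> w = ?e"
    using dist_exact_con2[OF d e] by blast
  have "w \<cdot> ?e = mzero Z (shO C X)"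
    by (simp only: cmp_plus_right[OF p arr_neg[OF id] w] cmp_neg_right[OF id w] cmp_idr[OF w] wp plus_neg(1)[OF w])
  then have "?e \<cdot> ?e = t \<cdot> mzero Z (shO C X)"
    using cmp_assoc_arr[OF e w t(1)] t(2) by simp
  then have "?e \<cdot> ?e = mzero Z Z"
    using cmp_mzero_right[OF t(1) dist_Ob(3)[OF d]] by simp
  then show ?thesis
    by (rule unipotent_iso[OF p])
qed

text \<open>The inverses of \<open>a\<close> and \<open>b\<close> also commute with the first maps,
  so \<open>TR3\<close> gives some \<open>e\<close> in the opposite direction. Fillers are not
  unique, so \<open>ec\<close> and \<open>ce\<close> need not be identities; but they fix the maps
  of the triangles and are invertible by \<open>dist_endo_iso\<close>.\<close>

lemma dist_third_iso:
  assumes d: "dist X Y Z u v w" and d': "dist X' Y' Z' u' v' w'"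
    and a: "iso a X X'" and b: "iso b Y Y'" and c: "arr c Z Z'"
    and bu: "b \<cdot> u = u' \<cdot> a" and cv: "c \<cdot> v = v' \<cdot> b" and wc: "shM C a \<cdot> w = w' \<cdot> c"
  shows "iso c Z Z'"
proof -
  note u = dist_arr(1)[OF d] and v = dist_arr(2)[OF d] and w = dist_arr(3)[OF d]
  note u' = dist_arr(1)[OF d'] and v' = dist_arr(2)[OF d'] and w' = dist_arr(3)[OF d']
  note aa = iso_arr[OF a] and bb = iso_arr[OF b]
  obtain a' where a': "arr a' X' X" "a' \<cdot> a = idm C X" "a \<cdot> a' = idm C X'"
    using a by (auto simp: iso_iff)
  obtain b' where b': "arr b' Y' Y" "b' \<cdot> b = idm C Y" "b \<cdot> b' = idm C Y'"
    using b by (auto simp: iso_iff)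
  have "b' \<cdot> u' = b' \<cdot> ((u' \<cdot> a) \<cdot> a')"
    using cmp_assoc_arr[OF a'(1) aa u'] a'(3) cmp_idr[OF u'] by simp
  also have "\<dots> = b' \<cdot> (b \<cdot> (u \<cdot> a'))"
    using bu cmp_assoc_arr[OF a'(1) u bb] by simp
  also have "\<dots> = u \<cdot> a'"
    by (rule cmp_cancel_left[OF arr_cmp[OF a'(1) u] bb b'(1,2)])
  finally obtain e where "e \<in> Hom C Z' Z" and ev: "e \<cdot> v' = v \<cdot> b'" and we: "shM C a' \<cdot> w' = w \<cdot> e"
    using TR3[OF d' d arr_Hom[OF a'(1)] arr_Hom[OF b'(1)]] by blast
  then have e: "arr e Z' Z"
    using dist_Ob[OF d] dist_Ob[OF d'] by (simp add: arr_def)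
  note sa = arr_sh[OF aa] and sa' = arr_sh[OF a'(1)]
  have sa1: "shM C a' \<cdot> shM C a = idm C (shO C X)"
    using sh_cmp_arr[OF aa a'(1)] a'(2) sh_id[OF dist_Ob(1)[OF d]] by simp
  have sa2: "shM C a \<cdot> shM C a' = idm C (shO C X')"
    using sh_cmp_arr[OF a'(1) aa] a'(3) sh_id[OF dist_Ob(1)[OF d']] by simp
  have "(e \<cdot> c) \<cdot> v = (e \<cdot> v') \<cdot> b"
    using cmp_assoc_arr[OF v c e] cv cmp_assoc_arr[OF bb v' e] by simp
  also have "\<dots> = v"
    using ev cmp_assoc_arr[OF bb b'(1) v] b'(2) cmp_idr[OF v] by simp
  finally have 1: "(e \<cdot> c) \<cdot> v = v" .
  have "w \<cdot> (e \<cdot> c) = shM C a' \<cdot> (w' \<cdot> c)"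
    using cmp_assoc_arr[OF c e w] we cmp_assoc_arr[OF c w' sa'] by simp
  also have "\<dots> = w"
    using cmp_cancel_left[OF w sa sa' sa1] wc by simp
  finally have 2: "w \<cdot> (e \<cdot> c) = w" .
  have "(c \<cdot> e) \<cdot> v' = (c \<cdot> v) \<cdot> b'"
    using cmp_assoc_arr[OF v' e c] ev cmp_assoc_arr[OF b'(1) v c] by simp
  also have "\<dots> = v'"
    using cv cmp_assoc_arr[OF b'(1) bb v'] b'(3) cmp_idr[OF v'] by simp
  finally have 3: "(c \<cdot> e) \<cdot> v' = v'" .
  have "w' \<cdot> (c \<cdot> e) = shM C a \<cdot> (w \<cdot> e)"
    using cmp_assoc_arr[OF e c w'] wc cmp_assoc_arr[OF e w sa] by simp
  also have "\<dots> = w'"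
    using cmp_cancel_left[OF w' sa' sa sa2] we by simp
  finally have 4: "w' \<cdot> (c \<cdot> e) = w'" .
  obtain p where p: "arr p Z Z" "p \<cdot> (e \<cdot> c) = idm C Z"
    using dist_endo_iso[OF d arr_cmp[OF c e] 1 2] by (auto simp: iso_iff)
  obtain q where q: "arr q Z' Z'" "(c \<cdot> e) \<cdot> q = idm C Z'"
    using dist_endo_iso[OF d' arr_cmp[OF e c] 3 4] by (auto simp: iso_iff)
  show ?thesis
    using iso_if_left_right_inverse[OF c arr_cmp[OF e p(1)] arr_cmp[OF q(1) e]]
      p(2) q(2) cmp_assoc_arr[OF c e p(1)] cmp_assoc_arr[OF q(1) e c] by simp
qed

lemma dist_iso:
  assumes d: "dist X Y Z u v w" and "arr u' X' Y'" "arr v' Y' Z'" "arr w' Z' (shO C X')"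
    and "iso a X X'" "iso b Y Y'" "iso c Z Z'"
    and "b \<cdot> u = u' \<cdot> a" "c \<cdot> v = v' \<cdot> b" "shM C a \<cdot> w = w' \<cdot> c"
  shows "dist X' Y' Z' u' v' w'"
  by (rule TR1_iso[OF d, of X' Y' Z' u' v' w' a b c]) (use assms in \<open>simp_all add: arr_def iso_def\<close>)

lemma dist_replace_cone:
  assumes d: "dist X Y Z u v w" and c: "iso c Z W"
  shows "\<exists>v' w'. dist X Y W u v' w'"
proof -
  note u = dist_arr(1)[OF d] and v = dist_arr(2)[OF d] and w = dist_arr(3)[OF d] and cc = iso_arr[OF c]
  note X = dist_Ob(1)[OF d] and Y = dist_Ob(2)[OF d]
  obtain c' where c': "arr c' W Z" "c' \<cdot> c = idm C Z"
    using c by (auto simp: iso_iff)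
  have "shM C (idm C X) \<cdot> w = (w \<cdot> c') \<cdot> c"
    using sh_id[OF X] cmp_idl[OF w] cmp_assoc_arr[OF cc c'(1) w] c'(2) cmp_idr[OF w] by simp
  then have "dist X Y W u (c \<cdot> v) (w \<cdot> c')"
    using dist_iso[OF d u arr_cmp[OF v cc] arr_cmp[OF c'(1) w] iso_id[OF X] iso_id[OF Y] c]
      cmp_idl[OF u] cmp_idr[OF u] cmp_idr[OF arr_cmp[OF v cc]] by simp
  then show ?thesis by blast
qed

text \<open>The isomorphism hidden in \<open>cone_iso\<close> can be absorbed into the last two maps
  of the triangle.\<close>

lemma cone_iso_iff_dist:
  assumes W: "W \<in> Ob C"
  shows "cone_iso C X Y u W \<longleftrightarrow> (\<exists>v w. dist X Y W u v w)"
proof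
  assume "cone_iso C X Y u W"
  then obtain Z v w where d: "dist X Y Z u v w" "isomorphic C Z W"
    unfolding cone_iso_def by blast
  then show "\<exists>v w. dist X Y W u v w"
    using dist_replace_cone[OF d(1)] isomorphic_iff[OF dist_Ob(3)[OF d(1)] W] by blast
next
  assume "\<exists>v w. dist X Y W u v w"
  then show "cone_iso C X Y u W"
    using isomorphic_iff[OF W W] iso_id[OF W] unfolding cone_iso_def by blast
qed

lemma dist_cone_unique:
  assumes d: "dist X Y Z u v w" and d': "dist X Y Z' u v' w'"
  obtains c where "iso c Z Z'"
proof -
  note u = dist_arr(1)[OF d] and X = dist_Ob(1)[OF d] and Y = dist_Ob(2)[OF d]
  have eq: "idm C Y \<cdot> u = u \<cdot> idm C X"
    using cmp_idl[OF u] cmp_idr[OF u] by simp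
  then obtain c where c: "c \<in> Hom C Z Z'" "c \<cdot> v = v' \<cdot> idm C Y" "shM C (idm C X) \<cdot> w = w' \<cdot> c"
    using TR3[OF d d' arr_Hom[OF arr_id[OF X]] arr_Hom[OF arr_id[OF Y]]] by blast
  have "iso c Z Z'"
    by (rule dist_third_iso[OF d d' iso_id[OF X] iso_id[OF Y] _ eq c(2,3)])
      (rule arrI[OF dist_Ob(3)[OF d] dist_Ob(3)[OF d'] c(1)])
  then show thesis by (rule that)
qed

text \<open>The form in which the octahedral axiom is used: it provides two triangles with one
  common third object, and then every cone condition on one map carries over to the other.\<close>

lemma cone_iso_transfer:
  assumes d: "dist X Y Z u v w" and d': "dist X' Y' Z u' v' w'" and W: "W \<in> Ob C"
  shows "cone_iso C X Y u W \<longleftrightarrow> cone_iso C X' Y' u' W"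
  unfolding cone_iso_iff_dist[OF W]
  using dist_cone_unique[OF d] dist_cone_unique[OF d'] dist_replace_cone[OF d] dist_replace_cone[OF d']
  by metis

text \<open>Changing the sign on the middle object alone identifies the triangles over
  \<open>u\<close> and \<open>-u\<close>. It is needed because \<open>Hom_to_sum\<close> puts its
  cone condition on \<open>m'\<close>, while the component of the morphism is
  \<open>-m'\<close>.\<close>

lemma cone_iso_negI:
  assumes W: "W \<in> Ob C" and "cone_iso C X Y u W"
  shows "cone_iso C X Y (mneg X Y u) W"
proof -
  obtain v w where d: "dist X Y W u v w"
    using assms cone_iso_iff_dist[OF W] by blast
  note u = dist_arr(1)[OF d] and v = dist_arr(2)[OF d] and w = dist_arr(3)[OF d]
  note X = dist_Ob(1)[OF d] and Y = dist_Ob(2)[OF d]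
  note iY = arr_id[OF Y]
  have "mneg Y Y (idm C Y) \<cdot> u = mneg X Y u \<cdot> idm C X"
    using cmp_neg_left[OF u iY] cmp_idl[OF u] cmp_idr[OF arr_neg[OF u]] by simp
  moreover have "idm C W \<cdot> v = mneg Y W v \<cdot> mneg Y Y (idm C Y)"
    using cmp_neg_left[OF arr_neg[OF iY] v] cmp_neg_right[OF iY v] cmp_idr[OF v] cmp_idl[OF v] neg_neg[OF v]
    by simp
  moreover have "shM C (idm C X) \<cdot> w = w \<cdot> idm C W"
    using sh_id[OF X] cmp_idl[OF w] cmp_idr[OF w] by simp
  ultimately have "dist X Y W (mneg X Y u) (mneg Y W v) w"
    by (rule dist_iso[OF d arr_neg[OF u] arr_neg[OF v] w iso_id[OF X] iso_neg[OF iso_id[OF Y]] iso_id[OF W]])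
  then show ?thesis
    using cone_iso_iff_dist[OF W] by blast
qed

lemma cone_iso_neg:
  assumes "W \<in> Ob C" and u: "arr u X Y"
  shows "cone_iso C X Y (mneg X Y u) W \<longleftrightarrow> cone_iso C X Y u W"
  using cone_iso_negI[OF assms(1), of X Y u] cone_iso_negI[OF assms(1), of X Y "mneg X Y u"] neg_neg[OF u]
  by auto

end

section \<open>Morphisms from and to a biproduct\<close>

context linear_category
begin

lemma biproduct_arr:
  assumes "is_biproduct C A B S iA iB pA pB" "A \<in> Ob C" "B \<in> Ob C"
  shows "arr iA A S" "arr iB B S" "arr pA S A" "arr pB S B"
  using assms by (simp_all add: is_biproduct_def arr_def)

lemma biproduct_eqs:
  assumes "is_biproduct C A B S iA iB pA pB"
  shows "pA \<cdot> iA = idm C A" "pB \<cdot> iB = idm C B" "pA \<cdot> iB = mzero B A" "pB \<cdot> iA = mzero A B"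
    "madd S S (iA \<cdot> pA) (iB \<cdot> pB) = idm C S"
  using assms by (simp_all add: is_biproduct_def)

lemma biproduct_swap:
  assumes b: "is_biproduct C A B S iA iB pA pB" and "A \<in> Ob C" "B \<in> Ob C"
  shows "is_biproduct C B A S iB iA pB pA"
proof -
  note a = biproduct_arr[OF assms]
  have "madd S S (iB \<cdot> pB) (iA \<cdot> pA) = idm C S"
    using plus_comm[OF arr_cmp[OF a(4,2)] arr_cmp[OF a(3,1)]] biproduct_eqs(5)[OF b] by simp
  then show ?thesis
    using b by (simp add: is_biproduct_def)
qed

section \<open>Automorphism groups and their orbits\<close>

lemma End_monoid:
  assumes L: "L \<in> Ob C"
  shows "Group.monoid (End_alg C L)"
  by (rule Group.monoidI)
    (use L cmp_closed[OF L L L] id_closed[OF L] cmp_assoc[OF L L L L] id_left[OF L L] id_right[OF L L]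
      in \<open>simp_all add: End_alg_def\<close>)

lemma carrier_Aut:
  assumes "L \<in> Ob C"
  shows "carrier (Aut C L) = {a. iso a L L}"
  using assms by (auto simp: units_of_def Units_def End_alg_def iso_iff arr_def)

lemma Aut_group: "L \<in> Ob C \<Longrightarrow> group (Aut C L)"
  by (rule monoid.units_group[OF End_monoid])

lemma orbit_post_act:
  assumes "L \<in> Ob C"
  shows "orbit (Aut C L) (post_act C) g = {a \<cdot> g | a. iso a L L}"
  by (simp add: orbit_def post_act_def carrier_Aut[OF assms])

lemma orbit_pre_act:
  assumes "L \<in> Ob C"
  shows "orbit (Aut C L) (pre_act C L) g = {g \<cdot> a | a. iso a L L}"
proof -
  interpret A: group "Aut C L"
    by (rule Aut_group[OF assms])
  have "orbit (Aut C L) (pre_act C L) g = (\<lambda>a. g \<cdot> a) ` (\<lambda>a. inv\<^bsub>Aut C L\<^esub> a) ` carrier (Aut C L)"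
    by (auto simp: orbit_def pre_act_def)
  also have "(\<lambda>a. inv\<^bsub>Aut C L\<^esub> a) ` carrier (Aut C L) = carrier (Aut C L)"
    using A.inv_closed A.inv_inv by (metis (no_types, lifting) image_eqI image_subsetI subsetI subset_antisym)
  finally show ?thesis
    by (auto simp: carrier_Aut[OF assms])
qed

lemma orbit_post_act_refl:
  assumes "arr g S L"
  shows "g \<in> {a \<cdot> g | a. iso a L L}"
  using cmp_idl[OF assms] iso_id[OF arr_cod[OF assms]] by (metis (mono_tags, lifting) mem_Collect_eq)

lemma orbit_pre_act_refl:
  assumes "arr g L S"
  shows "g \<in> {g \<cdot> a | a. iso a L L}"
  using cmp_idr[OF assms] iso_id[OF arr_dom[OF assms]] by (metis (mono_tags, lifting) mem_Collect_eq)

lemma orbit_post_act_eq_iff: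
  assumes g1: "arr g1 S L" and g2: "arr g2 S L"
  shows "{a \<cdot> g1 | a. iso a L L} = {a \<cdot> g2 | a. iso a L L} \<longleftrightarrow> (\<exists>a. iso a L L \<and> g2 = a \<cdot> g1)"
proof
  assume "{a \<cdot> g1 | a. iso a L L} = {a \<cdot> g2 | a. iso a L L}"
  then show "\<exists>a. iso a L L \<and> g2 = a \<cdot> g1"
    using orbit_post_act_refl[OF g2] by auto
next
  assume "\<exists>a. iso a L L \<and> g2 = a \<cdot> g1"
  then obtain a where a: "iso a L L" "g2 = a \<cdot> g1"
    by blast
  obtain b where b: "iso b L L" "b \<cdot> a = idm C L"
    using iso_inverse[OF a(1)] .
  have "b \<cdot> g2 = g1"
    using cmp_cancel_left[OF g1 iso_arr[OF a(1)] iso_arr[OF b(1)] b(2)] a(2) by simp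
  have "c \<cdot> g2 = (c \<cdot> a) \<cdot> g1" if "iso c L L" for c
    using a cmp_assoc_arr[OF g1 iso_arr[OF a(1)] iso_arr[OF that]] by simp
  moreover have "c \<cdot> g1 = (c \<cdot> b) \<cdot> g2" if "iso c L L" for c
    using \<open>b \<cdot> g2 = g1\<close> cmp_assoc_arr[OF g2 iso_arr[OF b(1)] iso_arr[OF that]] by simp
  ultimately show "{a \<cdot> g1 | a. iso a L L} = {a \<cdot> g2 | a. iso a L L}"
    using iso_cmp[OF a(1)] iso_cmp[OF b(1)] by blast
qed

text \<open>The representatives are exchanged in comparison with
  \<open>orbit_post_act_eq_iff\<close>. This fits a morphism from the first triangle to the second
  that is the identity on \<open>S\<close>: it satisfies \<open>g2 = a \<cdot> g1\<close> but
  \<open>g1' = g2' \<cdot> b\<close>.\<close>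

lemma orbit_pre_act_eq_iff:
  assumes g1: "arr g1 L S" and g2: "arr g2 L S"
  shows "{g1 \<cdot> a | a. iso a L L} = {g2 \<cdot> a | a. iso a L L} \<longleftrightarrow> (\<exists>a. iso a L L \<and> g1 = g2 \<cdot> a)"
proof
  assume "{g1 \<cdot> a | a. iso a L L} = {g2 \<cdot> a | a. iso a L L}"
  then show "\<exists>a. iso a L L \<and> g1 = g2 \<cdot> a"
    using orbit_pre_act_refl[OF g1] by auto
next
  assume "\<exists>a. iso a L L \<and> g1 = g2 \<cdot> a"
  then obtain a where a: "iso a L L" "g1 = g2 \<cdot> a"
    by blast
  obtain b where b: "iso b L L" "a \<cdot> b = idm C L"
    using iso_inverse[OF a(1)] by blast
  have "g1 \<cdot> b = g2"
    using cmp_assoc_arr[OF iso_arr[OF b(1)] iso_arr[OF a(1)] g2] cmp_idr[OF g2] a(2) b(2) by simp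
  have "g1 \<cdot> c = g2 \<cdot> (a \<cdot> c)" if "iso c L L" for c
    using a cmp_assoc_arr[OF iso_arr[OF that] iso_arr[OF a(1)] g2] by simp
  moreover have "g2 \<cdot> c = g1 \<cdot> (b \<cdot> c)" if "iso c L L" for c
    using \<open>g1 \<cdot> b = g2\<close> cmp_assoc_arr[OF iso_arr[OF that] iso_arr[OF b(1)] g1] by simp
  ultimately show "{g1 \<cdot> a | a. iso a L L} = {g2 \<cdot> a | a. iso a L L}"
    using iso_cmp[OF _ a(1)] iso_cmp[OF _ b(1)] by blast
qed

lemma from_sum_components:
  assumes b: "is_biproduct C M X S iM iX pM pX" and m: "arr m M L" and f: "arr f X L"
  shows "arr (from_sum C S pM pX L m f) S L"
    "from_sum C S pM pX L m f \<cdot> iM = m" "from_sum C S pM pX L m f \<cdot> iX = f"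
proof -
  note a = biproduct_arr[OF b arr_dom[OF m] arr_dom[OF f]] and e = biproduct_eqs[OF b]
  note mp = arr_cmp[OF a(3) m] and fp = arr_cmp[OF a(4) f]
  show "arr (from_sum C S pM pX L m f) S L"
    unfolding from_sum_def by (rule arr_plus[OF mp fp])
  show "from_sum C S pM pX L m f \<cdot> iM = m"
    by (simp only: from_sum_def cmp_plus_left[OF a(1) mp fp] cmp_assoc_arr[OF a(1) a(3) m]
        cmp_assoc_arr[OF a(1) a(4) f] e cmp_idr[OF m] cmp_mzero_right[OF f arr_dom[OF m]] plus_mzero(1)[OF m])
  show "from_sum C S pM pX L m f \<cdot> iX = f"
    by (simp only: from_sum_def cmp_plus_left[OF a(2) mp fp] cmp_assoc_arr[OF a(2) a(3) m]
        cmp_assoc_arr[OF a(2) a(4) f] e cmp_idr[OF f] cmp_mzero_right[OF m arr_dom[OF f]] plus_mzero(2)[OF f])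
qed

lemma from_sum_eta:
  assumes b: "is_biproduct C M X S iM iX pM pX" and M: "M \<in> Ob C" and X: "X \<in> Ob C"
    and g: "arr g S L"
  shows "from_sum C S pM pX L (g \<cdot> iM) (g \<cdot> iX) = g"
proof -
  note a = biproduct_arr[OF b M X] and e = biproduct_eqs[OF b]
  show ?thesis
    by (simp only: from_sum_def cmp_assoc_arr[OF a(3) a(1) g] cmp_assoc_arr[OF a(4) a(2) g]
        cmp_plus_right[OF arr_cmp[OF a(3) a(1)] arr_cmp[OF a(4) a(2)] g, symmetric] e cmp_idr[OF g])
qed

lemma to_sum_components:
  assumes b: "is_biproduct C M X S iM iX pM pX" and f: "arr f L M" and n: "arr n L X"
  shows "arr (to_sum C S iM iX L f n) L S"
    "pM \<cdot> to_sum C S iM iX L f n = f" "pX \<cdot> to_sum C S iM iX L f n = n"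
proof -
  note a = biproduct_arr[OF b arr_cod[OF f] arr_cod[OF n]] and e = biproduct_eqs[OF b]
  note fi = arr_cmp[OF f a(1)] and ni = arr_cmp[OF n a(2)]
  show "arr (to_sum C S iM iX L f n) L S"
    unfolding to_sum_def by (rule arr_plus[OF fi ni])
  show "pM \<cdot> to_sum C S iM iX L f n = f"
    by (simp only: to_sum_def cmp_plus_right[OF fi ni a(3)] cmp_assoc_arr[OF f a(1,3), symmetric]
        cmp_assoc_arr[OF n a(2,3), symmetric] e cmp_idl[OF f] cmp_mzero_left[OF n arr_cod[OF f]] plus_mzero(1)[OF f])
  show "pX \<cdot> to_sum C S iM iX L f n = n"
    by (simp only: to_sum_def cmp_plus_right[OF fi ni a(4)] cmp_assoc_arr[OF f a(1,4), symmetric]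
        cmp_assoc_arr[OF n a(2,4), symmetric] e cmp_idl[OF n] cmp_mzero_left[OF f arr_cod[OF n]] plus_mzero(2)[OF n])
qed

lemma to_sum_eta:
  assumes b: "is_biproduct C M X S iM iX pM pX" and M: "M \<in> Ob C" and X: "X \<in> Ob C"
    and g: "arr g L S"
  shows "to_sum C S iM iX L (pM \<cdot> g) (pX \<cdot> g) = g"
proof -
  note a = biproduct_arr[OF b M X] and e = biproduct_eqs[OF b]
  show ?thesis
    by (simp only: to_sum_def cmp_assoc_arr[OF g a(3) a(1), symmetric] cmp_assoc_arr[OF g a(4) a(2), symmetric]
        cmp_plus_left[OF g arr_cmp[OF a(3) a(1)] arr_cmp[OF a(4) a(2)], symmetric] e cmp_idl[OF g])
qed

end

section \<open>The direct sum triangle and the correspondence through shared triangles\<close>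

context triangulated_linear_category
begin

text \<open>Any cone \<open>D\<close> of \<open>iA\<close> is compared with \<open>B\<close>. The
  injection \<open>iA\<close> splits, so the connecting map vanishes; \<open>pB\<close> factors
  through \<open>D\<close> by some \<open>c\<close>, and \<open>v \<cdot> iB\<close> is a right
  inverse of \<open>c\<close>.\<close>

lemma dist_biproduct:
  assumes b: "is_biproduct C A B S iA iB pA pB" and A: "A \<in> Ob C" and B: "B \<in> Ob C"
  shows "dist A S B iA pB (mzero B (shO C A))"
proof -
  note a = biproduct_arr[OF b A B] and e = biproduct_eqs[OF b]
  note S = arr_cod[OF a(1)]
  obtain D v w where d: "dist A S D iA v w"
    using TR1_cone[OF A S arr_Hom[OF a(1)]] by blast
  note v = dist_arr(2)[OF d] and w = dist_arr(3)[OF d] and D = dist_Ob(3)[OF d]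
  have "shM C pA \<cdot> (shM C iA \<cdot> w) = w"
    by (rule cmp_cancel_left[OF w arr_sh[OF a(1)] arr_sh[OF a(3)]])
      (simp only: sh_cmp_arr[OF a(1,3), symmetric] e(1) sh_id[OF A])
  then have w0: "w = mzero D (shO C A)"
    using dist_cmp_zero3[OF d] cmp_mzero_right[OF arr_sh[OF a(3)] D] by simp
  obtain c where c: "arr c D B" "c \<cdot> v = pB"
    using dist_exact_con1[OF d a(4) e(4)] .
  note q = arr_cmp[OF c(1) arr_cmp[OF a(2) v]]
  have "v = v \<cdot> madd S S (iA \<cdot> pA) (iB \<cdot> pB)"
    using e(5) cmp_idr[OF v] by simp
  also have "\<dots> = madd S D ((v \<cdot> iA) \<cdot> pA) (v \<cdot> (iB \<cdot> pB))"
    by (simp only: cmp_plus_right[OF arr_cmp[OF a(3,1)] arr_cmp[OF a(4,2)] v] cmp_assoc_arr[OF a(3,1) v])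
  also have "\<dots> = v \<cdot> (iB \<cdot> pB)"
    by (simp only: dist_cmp_zero1[OF d] cmp_mzero_left[OF a(3) D] plus_mzero(2)[OF arr_cmp[OF arr_cmp[OF a(4,2)] v]])
  finally have viB: "v \<cdot> (iB \<cdot> pB) = v"
    by (rule sym)
  \<comment> \<open>Since \<open>v\<close> kills \<open>iA\<close>, it equals
    \<open>v \<cdot> (iB \<cdot> pB)\<close>. Hence \<open>(v \<cdot> iB) \<cdot> c\<close> fixes
    \<open>v\<close>, and also \<open>w\<close>, which is zero; so it is invertible and
    \<open>c\<close> has a left inverse too.\<close>
  have "((v \<cdot> iB) \<cdot> c) \<cdot> v = v"
    using cmp_assoc_arr[OF v c(1) arr_cmp[OF a(2) v]] c(2) cmp_assoc_arr[OF a(4,2) v] viB by simp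
  moreover have "w \<cdot> ((v \<cdot> iB) \<cdot> c) = w"
    unfolding w0 by (rule cmp_mzero_left[OF q sh_Ob[OF A]])
  ultimately have "iso ((v \<cdot> iB) \<cdot> c) D D"
    by (rule dist_endo_iso[OF d q])
  then obtain p where p: "arr p D D" "p \<cdot> ((v \<cdot> iB) \<cdot> c) = idm C D"
    by (auto simp: iso_iff)
  have "c \<cdot> (v \<cdot> iB) = idm C B"
    using cmp_assoc_arr[OF a(2) v c(1)] c(2) e(2) by simp
  moreover have "(p \<cdot> (v \<cdot> iB)) \<cdot> c = idm C D"
    using cmp_assoc_arr[OF c(1) arr_cmp[OF a(2) v] p(1)] p(2) by simp
  ultimately have "iso c D B"
    using iso_if_left_right_inverse[OF c(1) arr_cmp[OF arr_cmp[OF a(2) v] p(1)] arr_cmp[OF a(2) v]] by blast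
  moreover have "idm C S \<cdot> iA = iA \<cdot> idm C A"
    using cmp_idl[OF a(1)] cmp_idr[OF a(1)] by simp
  moreover have "c \<cdot> v = pB \<cdot> idm C S"
    using c(2) cmp_idr[OF a(4)] by simp
  moreover have "shM C (idm C A) \<cdot> w = mzero B (shO C A) \<cdot> c"
    using sh_id[OF A] cmp_idl[OF w] cmp_mzero_left[OF c(1) sh_Ob[OF A]] w0 by simp
  ultimately show ?thesis
    using dist_iso[OF d a(1) a(4) arr_mzero[OF B sh_Ob[OF A]] iso_id[OF A] iso_id[OF S]] by blast
qed

text \<open>The octahedral axiom for \<open>pM \<circ> g'\<close>; the cone of \<open>pM\<close> is \<open>X[1]\<close>.\<close>

lemma dist_common_cone:
  assumes b: "is_biproduct C M X S iM iX pM pX" and M: "M \<in> Ob C" and X: "X \<in> Ob C"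
    and d: "dist L' S L g' g h"
  obtains D v w v' w' where "dist L' M D (pM \<cdot> g') v w" "dist X L D (g \<cdot> iX) v' w'"
proof -
  note a = biproduct_arr[OF b M X]
  note g' = dist_arr(1)[OF d] and g = dist_arr(2)[OF d]
  have dp: "dist S M (shO C X) pM (mzero M (shO C X)) (mneg (shO C X) (shO C S) (shM C iX))"
    by (rule dist_rotate[OF dist_biproduct[OF biproduct_swap[OF b M X] X M]])
  obtain D v w where D: "dist L' M D (pM \<cdot> g') v w"
    using TR1_cone[OF arr_dom[OF g'] M arr_Hom[OF arr_cmp[OF g' a(3)]]] by blast
  obtain v' w' where v': "v' \<in> Hom C L D" and w': "w' \<in> Hom C D (shO C X)"
    and d': "dist L D (shO C X) v' w' (shM C g \<cdot> mneg (shO C X) (shO C S) (shM C iX))"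
    using TR4[OF d dp D] by blast
  \<comment> \<open>The octahedron yields a triangle on \<open>L\<close>, \<open>D\<close>,
    \<open>X[1]\<close>. The sign in its last map is exactly the rotation sign for
    \<open>g \<cdot> iX\<close>, so it rotates back to one on \<open>X\<close>, \<open>L\<close>,
    \<open>D\<close>.\<close>
  have "shM C g \<cdot> mneg (shO C X) (shO C S) (shM C iX) = mneg (shO C X) (shO C L) (shM C (g \<cdot> iX))"
    by (simp only: cmp_neg_right[OF arr_sh[OF a(2)] arr_sh[OF g]] sh_cmp_arr[OF a(2) g])
  then have "dist X L D (g \<cdot> iX) v' w'"
    using d' dist_rotate_iff[OF arr_cmp[OF a(2) g] dist_arr(1,2)[OF d']] by simp
  then show thesis
    using that D by blast
qed

text \<open>Backward rotation: \<open>-w\<close> ends in a shift at both sides, hence is itself a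
  shift by fullness.\<close>

lemma dist_complete_left:
  assumes d: "dist S L (shO C L') g v w" and L': "L' \<in> Ob C"
  obtains g' where "dist L' S L g' g v"
proof -
  note g = dist_arr(1)[OF d] and v = dist_arr(2)[OF d] and w = dist_arr(3)[OF d]
  obtain g' where g': "arr g' L' S" "shM C g' = mneg (shO C L') (shO C S) w"
    using sh_full[OF L' dist_Ob(1)[OF d] arr_neg[OF w]] .
  then have "dist L' S L g' g v"
    using dist_rotate_iff[OF g'(1) g v] neg_neg[OF w] d by simp
  then show thesis by (rule that)
qed

lemma dist_precompose_iso:
  assumes d: "dist L' S L g' g h" and b: "iso b L' L'"
  shows "\<exists>h'. dist L' S L (g' \<cdot> b) g h'"
proof -
  note g' = dist_arr(1)[OF d] and g = dist_arr(2)[OF d] and h = dist_arr(3)[OF d]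
  obtain a where a: "iso a L' L'" "b \<cdot> a = idm C L'"
    using iso_inverse[OF b] by blast
  have "idm C S \<cdot> g' = (g' \<cdot> b) \<cdot> a"
    using cmp_idl[OF g'] cmp_assoc_arr[OF iso_arr[OF a(1)] iso_arr[OF b] g'] a(2) cmp_idr[OF g'] by simp
  moreover have "idm C L \<cdot> g = g \<cdot> idm C S"
    using cmp_idl[OF g] cmp_idr[OF g] by simp
  moreover have "shM C a \<cdot> h = (shM C a \<cdot> h) \<cdot> idm C L"
    using cmp_idr[OF arr_cmp[OF h arr_sh[OF iso_arr[OF a(1)]]]] by simp
  ultimately have "dist L' S L (g' \<cdot> b) g (shM C a \<cdot> h)"
    by (rule dist_iso[OF d arr_cmp[OF iso_arr[OF b] g'] g arr_cmp[OF h arr_sh[OF iso_arr[OF a(1)]]]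
        a(1) iso_id[OF dist_Ob(2)[OF d]] iso_id[OF dist_Ob(3)[OF d]]])
  then show ?thesis by blast
qed

text \<open>An isomorphism on one outer object, together with the identity on \<open>S\<close>,
  extends by \<open>TR3\<close> to the other outer object, and \<open>dist_third_iso\<close> makes
  the extension invertible. Starting from \<open>a\<close> on \<open>L\<close> requires the rotated
  triangles; the resulting automorphism of \<open>L'[1]\<close> is then pulled back to
  \<open>L'\<close>.\<close>

lemma dist_orbit_compat:
  assumes d1: "dist L' S L g1' g1 h1" and d2: "dist L' S L g2' g2 h2"
  shows "(\<exists>a. iso a L L \<and> g2 = a \<cdot> g1) \<longleftrightarrow> (\<exists>b. iso b L' L' \<and> g1' = g2' \<cdot> b)"
proof
  note L' = dist_Ob(1)[OF d1] and S = dist_Ob(2)[OF d1] and L = dist_Ob(3)[OF d1]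
  note g1' = dist_arr(1)[OF d1] and g2' = dist_arr(1)[OF d2]
    and g1 = dist_arr(2)[OF d1] and g2 = dist_arr(2)[OF d2]
  note sg1' = arr_sh[OF g1'] and sg2' = arr_sh[OF g2']
  {
    assume "\<exists>a. iso a L L \<and> g2 = a \<cdot> g1"
    then obtain a where a: "iso a L L" "a \<cdot> g1 = g2 \<cdot> idm C S"
      using cmp_idr[OF g2] by auto
    note r1 = dist_rotate[OF d1] and r2 = dist_rotate[OF d2]
    obtain c where "c \<in> Hom C (shO C L') (shO C L')" and c: "c \<cdot> h1 = h2 \<cdot> a"
      "shM C (idm C S) \<cdot> mneg (shO C L') (shO C S) (shM C g1') = mneg (shO C L') (shO C S) (shM C g2') \<cdot> c"
      using TR3[OF r1 r2 arr_Hom[OF arr_id[OF S]] arr_Hom[OF iso_arr[OF a(1)]] a(2)] by blast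
    then have c': "arr c (shO C L') (shO C L')"
      using sh_Ob[OF L'] by (simp add: arr_def)
    obtain b where b: "arr b L' L'" "shM C b = c"
      using sh_full[OF L' L' c'] .
    have "iso c (shO C L') (shO C L')"
      by (rule dist_third_iso[OF r1 r2 iso_id[OF S] a(1) c' a(2) c])
    then have "iso b L' L'"
      using iso_if_sh_iso[OF b(1)] b(2) by simp
    moreover have "mneg (shO C L') (shO C S) (shM C g1') = mneg (shO C L') (shO C S) (shM C g2' \<cdot> c)"
      using c(2) sh_id[OF S] cmp_idl[OF arr_neg[OF sg1']] cmp_neg_left[OF c' sg2'] by simp
    then have "shM C g1' = shM C g2' \<cdot> c"
      by (rule neg_inj[OF sg1' arr_cmp[OF c' sg2']])
    then have "g1' = g2' \<cdot> b"
      using sh_inj[OF g1' arr_cmp[OF b(1) g2']] sh_cmp_arr[OF b(1) g2'] b(2) by simp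
    ultimately show "\<exists>b. iso b L' L' \<and> g1' = g2' \<cdot> b"
      by blast
  }
  {
    assume "\<exists>b. iso b L' L' \<and> g1' = g2' \<cdot> b"
    then obtain b where b: "iso b L' L'" "idm C S \<cdot> g1' = g2' \<cdot> b"
      using cmp_idl[OF g1'] by auto
    obtain c where "c \<in> Hom C L L" and c: "c \<cdot> g1 = g2 \<cdot> idm C S" "shM C b \<cdot> h1 = h2 \<cdot> c"
      using TR3[OF d1 d2 arr_Hom[OF iso_arr[OF b(1)]] arr_Hom[OF arr_id[OF S]] b(2)] by blast
    then have c': "arr c L L"
      using L by (simp add: arr_def)
    have "iso c L L"
      by (rule dist_third_iso[OF d1 d2 b(1) iso_id[OF S] c' b(2) c])
    then show "\<exists>a. iso a L L \<and> g2 = a \<cdot> g1"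
      using c(1) cmp_idr[OF g2] by auto
  }
qed

text \<open>Components are recovered by restriction along the injections, so the pair
  \<open>m\<close>, \<open>f\<close> disappears and membership becomes a condition on
  \<open>g\<close> alone, ready to be compared along a triangle.\<close>

lemma mem_Hom_from_sum_iff:
  assumes b: "is_biproduct C M X S iM iX pM pX" and M: "M \<in> Ob C" and X: "X \<in> Ob C" and L: "L \<in> Ob C"
  shows "g \<in> Hom_from_sum C M X S pM pX L Y Z L' \<longleftrightarrow>
    arr g S L \<and> cone_iso C X L (g \<cdot> iX) Y \<and> cone_iso C M L (g \<cdot> iM) (shO C Z) \<and> cone_iso C S L g (shO C L')"
    (is "?l \<longleftrightarrow> ?r")
proof
  assume ?l
  then obtain m f where mf: "arr m M L" "arr f X L" "g = from_sum C S pM pX L m f"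
    "cone_iso C X L f Y" "cone_iso C M L m (shO C Z)" "cone_iso C S L g (shO C L')"
    unfolding Hom_from_sum_def using arrI[OF M L] arrI[OF X L] by blast
  note c = from_sum_components[OF b mf(1,2)]
  show ?r
    using mf(4,5,6) unfolding mf(3) c(2) c(3) by (intro conjI c(1)) assumption+
next
  assume r: ?r
  then have g: "arr g S L" by blast
  note a = biproduct_arr[OF b M X]
  show ?l
    unfolding Hom_from_sum_def
    by (rule CollectI, rule exI[of _ "g \<cdot> iM"], rule exI[of _ "g \<cdot> iX"])
      (use r arr_Hom[OF arr_cmp[OF a(1) g]] arr_Hom[OF arr_cmp[OF a(2) g]]
        in \<open>simp add: from_sum_eta[OF b M X g]\<close>)
qed

lemma mem_Hom_to_sum_iff:
  assumes b: "is_biproduct C M X S iM iX pM pX" and M: "M \<in> Ob C" and X: "X \<in> Ob C" and L': "L' \<in> Ob C"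
    and Z: "Z \<in> Ob C"
  shows "g \<in> Hom_to_sum C M X S iM iX L' Y Z L \<longleftrightarrow>
    arr g L' S \<and> cone_iso C L' M (pM \<cdot> g) Y \<and> cone_iso C L' X (pX \<cdot> g) (shO C Z) \<and> cone_iso C L' S g L"
    (is "?l \<longleftrightarrow> ?r")
proof
  assume ?l
  then obtain f m where mf: "arr f L' M" "arr m L' X" "g = to_sum C S iM iX L' f (mneg L' X m)"
    "cone_iso C L' M f Y" "cone_iso C L' X m (shO C Z)" "cone_iso C L' S g L"
    unfolding Hom_to_sum_def using arrI[OF L' M] arrI[OF L' X] by blast
  note c = to_sum_components[OF b mf(1) arr_neg[OF mf(2)]]
  have "cone_iso C L' X (mneg L' X m) (shO C Z)"
    using cone_iso_neg[OF sh_Ob[OF Z] mf(2)] mf(5) by simp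
  then show ?r
    using mf(4,6) unfolding mf(3) c(2) c(3) by (intro conjI c(1)) assumption+
next
  assume r: ?r
  then have g: "arr g L' S" by blast
  note a = biproduct_arr[OF b M X]
  note pg = arr_cmp[OF g a(4)]
  have n: "cone_iso C L' X (mneg L' X (pX \<cdot> g)) (shO C Z)"
    using cone_iso_neg[OF sh_Ob[OF Z] pg] r by simp
  show ?l
    unfolding Hom_to_sum_def
    by (rule CollectI, rule exI[of _ "pM \<cdot> g"], rule exI[of _ "mneg L' X (pX \<cdot> g)"])
      (use r n arr_Hom[OF arr_cmp[OF g a(3)]] arr_Hom[OF arr_neg[OF pg]]
        in \<open>simp add: neg_neg[OF pg] to_sum_eta[OF b M X g]\<close>)
qed

lemma mem_Hom_from_sum_iff_mem_Hom_to_sum: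
  assumes b: "is_biproduct C M X S iM iX pM pX" and M: "M \<in> Ob C" and X: "X \<in> Ob C"
    and Y: "Y \<in> Ob C" and Z: "Z \<in> Ob C" and d: "dist L' S L g' g h"
  shows "g \<in> Hom_from_sum C M X S pM pX L Y Z L' \<longleftrightarrow> g' \<in> Hom_to_sum C M X S iM iX L' Y Z L"
proof -
  note L' = dist_Ob(1)[OF d] and L = dist_Ob(3)[OF d]
  obtain D v w v' w' where "dist L' M D (pM \<cdot> g') v w" "dist X L D (g \<cdot> iX) v' w'"
    using dist_common_cone[OF b M X d] .
  then have 1: "cone_iso C L' M (pM \<cdot> g') Y \<longleftrightarrow> cone_iso C X L (g \<cdot> iX) Y"
    by (rule cone_iso_transfer[OF _ _ Y])
  \<comment> \<open>The same octahedron with the roles of \<open>M\<close> and \<open>X\<close>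
    exchanged handles the condition involving \<open>Z\<close>.\<close>
  obtain D v w v' w' where "dist L' X D (pX \<cdot> g') v w" "dist M L D (g \<cdot> iM) v' w'"
    using dist_common_cone[OF biproduct_swap[OF b M X] X M d] .
  then have 2: "cone_iso C L' X (pX \<cdot> g') (shO C Z) \<longleftrightarrow> cone_iso C M L (g \<cdot> iM) (shO C Z)"
    by (rule cone_iso_transfer[OF _ _ sh_Ob[OF Z]])
  have 3: "cone_iso C L' S g' L" "cone_iso C S L g (shO C L')"
    using cone_iso_iff_dist[OF L] cone_iso_iff_dist[OF sh_Ob[OF L']] d dist_rotate[OF d] by blast+
  show ?thesis
    using mem_Hom_from_sum_iff[OF b M X L, of g Y Z L'] mem_Hom_to_sum_iff[OF b M X L' Z, of g' Y L] 1 2 3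
      dist_arr[OF d] by blast
qed

lemma Hom_from_sum_ex_dist:
  assumes b: "is_biproduct C M X S iM iX pM pX" and M: "M \<in> Ob C" and X: "X \<in> Ob C"
    and Y: "Y \<in> Ob C" and Z: "Z \<in> Ob C" and L: "L \<in> Ob C" and L': "L' \<in> Ob C"
    and g: "g \<in> Hom_from_sum C M X S pM pX L Y Z L'"
  shows "\<exists>g' \<in> Hom_to_sum C M X S iM iX L' Y Z L. \<exists>h. dist L' S L g' g h"
proof -
  obtain v w where d: "dist S L (shO C L') g v w"
    using g mem_Hom_from_sum_iff[OF b M X L] cone_iso_iff_dist[OF sh_Ob[OF L']] by blast
  obtain g' where d': "dist L' S L g' g v"
    using dist_complete_left[OF d L'] .
  then show ?thesis
    using mem_Hom_from_sum_iff_mem_Hom_to_sum[OF b M X Y Z d'] g by blast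
qed

lemma Hom_to_sum_ex_dist:
  assumes b: "is_biproduct C M X S iM iX pM pX" and M: "M \<in> Ob C" and X: "X \<in> Ob C"
    and Y: "Y \<in> Ob C" and Z: "Z \<in> Ob C" and L: "L \<in> Ob C" and L': "L' \<in> Ob C"
    and g': "g' \<in> Hom_to_sum C M X S iM iX L' Y Z L"
  shows "\<exists>g \<in> Hom_from_sum C M X S pM pX L Y Z L'. \<exists>h. dist L' S L g' g h"
proof -
  obtain v w where d: "dist L' S L g' v w"
    using g' mem_Hom_to_sum_iff[OF b M X L' Z] cone_iso_iff_dist[OF L] by blast
  then show ?thesis
    using mem_Hom_from_sum_iff_mem_Hom_to_sum[OF b M X Y Z d] g' by blast
qed

end

section \<open>Orbits and stabilizers\<close>

text \<open>Abstract passage from a relation to a bijection of orbits: choose a representative and a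
  partner of it. The choices are harmless by \<open>compat\<close>, while \<open>inv\<close> makes
  the characterization by \<open>R\<close> hold for every pair and not only for the chosen
  ones.\<close>

lemma orbit_correspondence:
  assumes total: "\<And>x. x \<in> H \<Longrightarrow> \<exists>y \<in> H'. R x y" "\<And>y. y \<in> H' \<Longrightarrow> \<exists>x \<in> H. R x y"
    and compat: "\<And>x1 x2 y1 y2. \<lbrakk>x1 \<in> H; x2 \<in> H; y1 \<in> H'; y2 \<in> H'; R x1 y1; R x2 y2\<rbrakk>
      \<Longrightarrow> orb x1 = orb x2 \<longleftrightarrow> orb' y1 = orb' y2"
    and inv: "\<And>x y1 y2. \<lbrakk>x \<in> H; y1 \<in> H'; y2 \<in> H'; R x y1; orb' y1 = orb' y2\<rbrakk> \<Longrightarrow> R x y2"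
  shows "\<exists>\<phi>. bij_betw \<phi> (orb ` H) (orb' ` H') \<and> (\<forall>x \<in> H. \<forall>y \<in> H'. \<phi> (orb x) = orb' y \<longleftrightarrow> R x y)"
proof -
  define s where "s x = (SOME y. y \<in> H' \<and> R x y)" for x
  have s: "s x \<in> H' \<and> R x (s x)" if "x \<in> H" for x
    unfolding s_def using someI_ex[of "\<lambda>y. y \<in> H' \<and> R x y"] total(1)[OF that] by blast
  define r where "r B = (SOME x. x \<in> H \<and> orb x = B)" for B
  have r: "r B \<in> H \<and> orb (r B) = B" if "B \<in> orb ` H" for B
    unfolding r_def using someI_ex[of "\<lambda>x. x \<in> H \<and> orb x = B"] that by blast
  define \<phi> where "\<phi> B = orb' (s (r B))" for B
  have \<phi>: "\<phi> (orb x) = orb' y \<longleftrightarrow> R x y" if x: "x \<in> H" and y: "y \<in> H'" for x y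
  proof -
    have rx: "r (orb x) \<in> H" "orb (r (orb x)) = orb x"
      using r x by auto
    have "orb' (s (r (orb x))) = orb' (s x)"
      using compat[of "r (orb x)" x "s (r (orb x))" "s x"] rx s x by auto
    moreover have "orb' (s x) = orb' y \<longleftrightarrow> R x y"
      using inv[of x "s x" y] compat[of x x "s x" y] s[OF x] x y by auto
    ultimately show ?thesis
      by (simp add: \<phi>_def)
  qed
  have img: "\<phi> ` orb ` H = orb' ` H'"
  proof (intro equalityI subsetI)
    fix B assume "B \<in> \<phi> ` orb ` H"
    then obtain x where x: "x \<in> H" "B = \<phi> (orb x)"
      by blast
    then have "B = orb' (s x)"
      using \<phi>[of x "s x"] s[of x] by simp
    then show "B \<in> orb' ` H'"
      using s[OF x(1)] by blast
  next
    fix B assume "B \<in> orb' ` H'"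
    then obtain y where y: "y \<in> H'" "B = orb' y"
      by blast
    then obtain x where "x \<in> H" "R x y"
      using total(2) by blast
    then have "B = \<phi> (orb x)"
      using \<phi>[OF \<open>x \<in> H\<close> y(1)] y(2) by simp
    then show "B \<in> \<phi> ` orb ` H"
      using \<open>x \<in> H\<close> by blast
  qed
  have inj: "inj_on \<phi> (orb ` H)"
  proof (rule inj_onI)
    fix P Q assume "P \<in> orb ` H" "Q \<in> orb ` H" and eq: "\<phi> P = \<phi> Q"
    then obtain x z where x: "x \<in> H" "P = orb x" and z: "z \<in> H" "Q = orb z"
      by blast
    have "R z (s x)"
      using \<phi>[OF z(1), of "s x"] \<phi>[OF x(1), of "s x"] s[OF x(1)] eq x z by simp
    then show "P = Q"
      using compat[of x z "s x" "s x"] s[OF x(1)] x z by simp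
  qed
  show ?thesis
    unfolding bij_betw_def using img inj \<phi> by blast
qed

lemma card_eq_sum_orbits:
  assumes fin: "finite H" and refl: "\<And>x. x \<in> H \<Longrightarrow> x \<in> orb x"
    and sub: "\<And>x. x \<in> H \<Longrightarrow> orb x \<subseteq> H"
    and eq: "\<And>x y. \<lbrakk>x \<in> H; y \<in> orb x\<rbrakk> \<Longrightarrow> orb y = orb x"
  shows "card H = (\<Sum>B \<in> orb ` H. card B)"
proof -
  have "H = \<Union> (orb ` H)"
    using refl sub by blast
  moreover have "card (\<Union> (orb ` H)) = (\<Sum>B \<in> orb ` H. card B)"
  proof (rule card_Union_disjoint)
    show "pairwise disjnt (orb ` H)"
      unfolding pairwise_def disjnt_def using eq by blast
    show "finite B" if "B \<in> orb ` H" for B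
      using that sub fin finite_subset by blast
  qed
  ultimately show ?thesis by simp
qed

text \<open>Corresponding orbits may have different sizes; only the sizes weighted by
  \<open>p\<close> and \<open>p'\<close> have to agree.\<close>

lemma weighted_card_eq_if_orbits_correspond:
  fixes p p' :: "'c::comm_semiring_1"
  assumes H: "finite H" "\<And>x. x \<in> H \<Longrightarrow> x \<in> orb x" "\<And>x. x \<in> H \<Longrightarrow> orb x \<subseteq> H"
      "\<And>x y. \<lbrakk>x \<in> H; y \<in> orb x\<rbrakk> \<Longrightarrow> orb y = orb x"
    and H': "finite H'" "\<And>x. x \<in> H' \<Longrightarrow> x \<in> orb' x" "\<And>x. x \<in> H' \<Longrightarrow> orb' x \<subseteq> H'"
      "\<And>x y. \<lbrakk>x \<in> H'; y \<in> orb' x\<rbrakk> \<Longrightarrow> orb' y = orb' x"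
    and \<phi>: "bij_betw \<phi> (orb ` H) (orb' ` H')"
    and w: "\<And>x y. \<lbrakk>x \<in> H; y \<in> H'; \<phi> (orb x) = orb' y\<rbrakk>
      \<Longrightarrow> of_nat (card (orb x)) * p = of_nat (card (orb' y)) * p'"
  shows "of_nat (card H) * p = of_nat (card H') * p'"
proof -
  have "of_nat (card H) * p = (\<Sum>B \<in> orb ` H. of_nat (card B) * p)"
    by (simp add: card_eq_sum_orbits[OF H] sum_distrib_right)
  also have "\<dots> = (\<Sum>B \<in> orb ` H. of_nat (card (\<phi> B)) * p')"
  proof (rule sum.cong)
    fix B assume B: "B \<in> orb ` H"
    then obtain x where x: "x \<in> H" "B = orb x"
      by blast
    have "\<phi> B \<in> orb' ` H'"
      using \<phi> B unfolding bij_betw_def by blast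
    then obtain y where "y \<in> H'" "\<phi> B = orb' y"
      by blast
    then show "of_nat (card B) * p = of_nat (card (\<phi> B)) * p'"
      using w x by simp
  qed simp
  also have "\<dots> = (\<Sum>B \<in> orb' ` H'. of_nat (card B) * p')"
    by (rule sum.reindex_bij_betw[OF \<phi>])
  also have "\<dots> = of_nat (card H') * p'"
    by (simp add: card_eq_sum_orbits[OF H'] sum_distrib_right)
  finally show ?thesis .
qed

section \<open>Stabilizers described by the connecting morphism\<close>

context triangulated_linear_category
begin

lemma dist_postcompose_iso:
  assumes d: "dist L' S L g' g h" and a: "iso a L L"
  shows "\<exists>h'. dist L' S L g' (a \<cdot> g) h'"
proof -
  note g' = dist_arr(1)[OF d] and g = dist_arr(2)[OF d] and h = dist_arr(3)[OF d] and aa = iso_arr[OF a]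
  obtain b where b: "arr b L L" "b \<cdot> a = idm C L"
    using a by (auto simp: iso_iff)
  have "idm C S \<cdot> g' = g' \<cdot> idm C L'"
    using cmp_idl[OF g'] cmp_idr[OF g'] by simp
  moreover have "a \<cdot> g = (a \<cdot> g) \<cdot> idm C S"
    using cmp_idr[OF arr_cmp[OF g aa]] by simp
  moreover have "shM C (idm C L') \<cdot> h = (h \<cdot> b) \<cdot> a"
    using sh_id[OF dist_Ob(1)[OF d]] cmp_idl[OF h] cmp_assoc_arr[OF aa b(1) h] b(2) cmp_idr[OF h] by simp
  ultimately have "dist L' S L g' (a \<cdot> g) (h \<cdot> b)"
    by (rule dist_iso[OF d g' arr_cmp[OF g aa] arr_cmp[OF b(1) h]
        iso_id[OF dist_Ob(1)[OF d]] iso_id[OF dist_Ob(2)[OF d]] a])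
  then show ?thesis by blast
qed

lemma inj_on_one_plus:
  assumes "X \<in> Ob C" and "\<And>b. b \<in> B \<Longrightarrow> arr b X X"
  shows "inj_on (madd X X (idm C X)) B"
proof (rule inj_onI)
  fix x y assume "x \<in> B" "y \<in> B" and eq: "madd X X (idm C X) x = madd X X (idm C X) y"
  then have x: "arr x X X" and y: "arr y X X"
    using assms(2) by blast+
  note id = arr_id[OF assms(1)]
  have "madd X X (madd X X x (idm C X)) (mneg X X (idm C X)) = madd X X (madd X X y (idm C X)) (mneg X X (idm C X))"
    by (simp only: plus_comm[OF x id] plus_comm[OF y id] eq)
  then show "x = y"
    by (simp only: plus_diff_cancel(1)[OF x id] plus_diff_cancel(1)[OF y id])
qed

text \<open>If \<open>a\<close> fixes \<open>g\<close>, then \<open>a - 1\<close> kills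
  \<open>g\<close> and factors through \<open>h\<close> by exactness; conversely
  \<open>h \<cdot> g\<close> is zero.\<close>

lemma stabilizer_post_eq:
  assumes d: "dist L' S L g' g h"
  shows "{a. iso a L L \<and> a \<cdot> g = g} =
    madd L L (idm C L) ` (\<lambda>c. c \<cdot> h) ` {c. arr c (shO C L') L \<and> iso (madd L L (idm C L) (c \<cdot> h)) L L}"
    (is "?S = _ ` _ ` ?U")
proof -
  note g = dist_arr(2)[OF d] and h = dist_arr(3)[OF d]
  note L = dist_Ob(3)[OF d]
  note id = arr_id[OF L]
  show ?thesis
  proof (intro equalityI subsetI)
    fix a assume "a \<in> ?S"
    then have a: "iso a L L" "a \<cdot> g = g"
      by auto
    note aa = iso_arr[OF a(1)]
    let ?e = "madd L L a (mneg L L (idm C L))"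
    have e: "arr ?e L L"
      by (rule arr_plus[OF aa arr_neg[OF id]])
    have "?e \<cdot> g = mzero S L"
      by (simp only: cmp_plus_left[OF g aa arr_neg[OF id]] cmp_neg_left[OF g id] cmp_idl[OF g] a(2) plus_neg(1)[OF g])
    then obtain c where c: "arr c (shO C L') L" "c \<cdot> h = ?e"
      using dist_exact_con2[OF d e] by blast
    have "madd L L (idm C L) (c \<cdot> h) = a"
      by (simp only: c(2) plus_diff_cancel(2)[OF aa id])
    then show "a \<in> madd L L (idm C L) ` (\<lambda>c. c \<cdot> h) ` ?U"
      using a(1) c(1) by (intro image_eqI[of _ _ "c \<cdot> h"] image_eqI[of _ _ c]) simp_all
  next
    fix a assume "a \<in> madd L L (idm C L) ` (\<lambda>c. c \<cdot> h) ` ?U"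
    then obtain c where c: "arr c (shO C L') L" "iso a L L" "a = madd L L (idm C L) (c \<cdot> h)"
      by blast
    have "(c \<cdot> h) \<cdot> g = mzero S L"
      using cmp_assoc_arr[OF g h c(1)] dist_cmp_zero2[OF d] cmp_mzero_right[OF c(1) dist_Ob(2)[OF d]] by simp
    then have "a \<cdot> g = g"
      by (simp only: c(3) cmp_plus_left[OF g id arr_cmp[OF h c(1)]] cmp_idl[OF g] plus_mzero(1)[OF g])
    then show "a \<in> ?S"
      using c(2) by simp
  qed
qed

text \<open>The shift appears because \<open>hc\<close> is an endomorphism of \<open>L'[1]\<close>.
  Invertibility is expressed through \<open>1 + ch\<close>, so that the index set is literally the
  one in \<open>stabilizer_post_eq\<close>; \<open>iso_one_plus_swap\<close> translates.\<close>

lemma sh_stabilizer_pre_eq: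
  assumes d: "dist L' S L g' g h"
  shows "shM C ` {a. iso a L' L' \<and> g' \<cdot> a = g'} =
    madd (shO C L') (shO C L') (idm C (shO C L')) ` (\<lambda>c. h \<cdot> c) `
      {c. arr c (shO C L') L \<and> iso (madd L L (idm C L) (c \<cdot> h)) L L}"
    (is "shM C ` ?S = _ ` _ ` ?U")
proof -
  note g' = dist_arr(1)[OF d] and h = dist_arr(3)[OF d]
  note L' = dist_Ob(1)[OF d] and S = dist_Ob(2)[OF d]
  note id = arr_id[OF sh_Ob[OF L']] and sg' = arr_sh[OF g']
  let ?P = "shO C L'"
  show ?thesis
  proof (intro equalityI subsetI)
    fix b assume "b \<in> shM C ` ?S"
    then obtain a where a: "iso a L' L'" "g' \<cdot> a = g'" "b = shM C a"
      by blast
    have b: "iso b ?P ?P"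
      using sh_iso[OF a(1)] a(3) by simp
    have sb: "shM C g' \<cdot> b = shM C g'"
      using sh_cmp_arr[OF iso_arr[OF a(1)] g'] a(2,3) by simp
    note bb = iso_arr[OF b]
    let ?e = "madd ?P ?P b (mneg ?P ?P (idm C ?P))"
    have e: "arr ?e ?P ?P"
      by (rule arr_plus[OF bb arr_neg[OF id]])
    have "shM C g' \<cdot> ?e = mzero ?P (shO C S)"
      by (simp only: cmp_plus_right[OF bb arr_neg[OF id] sg'] cmp_neg_right[OF id sg'] cmp_idr[OF sg'] sb
          plus_neg(1)[OF sg'])
    then obtain c where c: "arr c ?P L" "h \<cdot> c = ?e"
      using dist_exact_cov3[OF d e] by blast
    have bc: "madd ?P ?P (idm C ?P) (h \<cdot> c) = b"
      by (simp only: c(2) plus_diff_cancel(2)[OF bb id])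
    then have "iso (madd L L (idm C L) (c \<cdot> h)) L L"
      using iso_one_plus_swap[OF c(1) h] b by simp
    then show "b \<in> madd ?P ?P (idm C ?P) ` (\<lambda>c. h \<cdot> c) ` ?U"
      using bc c(1) by (intro image_eqI[of _ _ "h \<cdot> c"] image_eqI[of _ _ c]) simp_all
  next
    fix b assume "b \<in> madd ?P ?P (idm C ?P) ` (\<lambda>c. h \<cdot> c) ` ?U"
    then obtain c where c: "arr c ?P L" "iso (madd L L (idm C L) (c \<cdot> h)) L L"
      "b = madd ?P ?P (idm C ?P) (h \<cdot> c)"
      by blast
    have b: "iso b ?P ?P"
      unfolding c(3) by (rule iso_one_plus_swap[OF h c(1,2)])
    have "shM C g' \<cdot> (h \<cdot> c) = mzero ?P (shO C S)"
      using cmp_assoc_arr[OF c(1) h sg'] dist_cmp_zero3[OF d] cmp_mzero_left[OF c(1) sh_Ob[OF S]] by simp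
    then have sb: "shM C g' \<cdot> b = shM C g'"
      by (simp only: c(3) cmp_plus_right[OF id arr_cmp[OF c(1) h] sg'] cmp_idr[OF sg'] plus_mzero(1)[OF sg'])
    obtain a where a: "arr a L' L'" "shM C a = b"
      using sh_full[OF L' L' iso_arr[OF b]] .
    have "iso a L' L'"
      using iso_if_sh_iso[OF a(1)] a(2) b by simp
    moreover have "g' \<cdot> a = g'"
      by (rule sh_inj[OF arr_cmp[OF a(1) g'] g']) (simp only: sh_cmp_arr[OF a(1) g'] a(2) sb)
    ultimately show "b \<in> shM C ` ?S"
      using a(2) by blast
  qed
qed

end

section \<open>Cardinalities of morphism spaces\<close>

lemma card_eq_card_image_times_fibre:
  assumes "finite A" and "\<And>x. x \<in> A \<Longrightarrow> card {y \<in> A. f y = f x} = k"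
  shows "card A = card (f ` A) * k"
proof -
  have "card A = (\<Sum>z \<in> f ` A. card {y \<in> A. f y = z})"
    using sum.image_gen[OF assms(1), of "\<lambda>_. 1::nat" f] by simp
  also have "\<dots> = (\<Sum>z \<in> f ` A. k)"
    by (rule sum.cong) (use assms(2) in auto)
  finally show ?thesis by simp
qed

context linear_category
begin

lemma Hom_eq_arr: "X \<in> Ob C \<Longrightarrow> Y \<in> Ob C \<Longrightarrow> Hom C X Y = {f. arr f X Y}"
  by (simp add: arr_def)

text \<open>The set \<open>A\<close> need not be a subgroup: it suffices that it is a union of
  cosets of the kernel of the additive map \<open>F\<close>. This covers both a whole Hom space and
  the set of \<open>c\<close> with \<open>1 + ch\<close> invertible.\<close>

lemma card_saturated_eq:
  assumes fin: "finite A" and A: "\<And>x. x \<in> A \<Longrightarrow> arr x X Y"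
    and F: "\<And>x. arr x X Y \<Longrightarrow> arr (F x) X' Y'"
    and add: "\<And>x y. arr x X Y \<Longrightarrow> arr y X Y \<Longrightarrow> F (madd X Y x y) = madd X' Y' (F x) (F y)"
    and sat: "\<And>x y. x \<in> A \<Longrightarrow> arr y X Y \<Longrightarrow> F y = F x \<Longrightarrow> y \<in> A"
  shows "card A = card (F ` A) * card {z. arr z X Y \<and> F z = mzero X' Y'}"
proof (rule card_eq_card_image_times_fibre[OF fin])
  fix x assume x: "x \<in> A"
  note ax = A[OF x]
  have "{y \<in> A. F y = F x} = madd X Y x ` {z. arr z X Y \<and> F z = mzero X' Y'}"
  proof (intro equalityI subsetI)
    fix y assume "y \<in> {y \<in> A. F y = F x}"
    then have y: "arr y X Y" "F y = F x"
      using A by auto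
    let ?z = "madd X Y y (mneg X Y x)"
    have z: "arr ?z X Y" and xz: "madd X Y x ?z = y"
      using arr_plus[OF y(1) arr_neg[OF ax]] plus_diff_cancel(2)[OF y(1) ax] .
    have "madd X' Y' (F x) (F ?z) = F x"
      using add[OF ax z] xz y(2) by simp
    then have "madd X' Y' (F ?z) (F x) = F x"
      using plus_comm[OF F[OF ax] F[OF z]] by simp
    then have "F ?z = mzero X' Y'"
      using plus_diff_cancel(1)[OF F[OF z] F[OF ax]] plus_neg(1)[OF F[OF ax]] by simp
    then show "y \<in> madd X Y x ` {z. arr z X Y \<and> F z = mzero X' Y'}"
      using z xz by (intro image_eqI[of _ _ ?z]) simp_all
  next
    fix y assume "y \<in> madd X Y x ` {z. arr z X Y \<and> F z = mzero X' Y'}"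
    then obtain z where z: "y = madd X Y x z" "arr z X Y" "F z = mzero X' Y'"
      by blast
    have "F y = F x"
      using add[OF ax z(2)] z plus_mzero(1)[OF F[OF ax]] by simp
    moreover have "arr y X Y"
      using arr_plus[OF ax z(2)] z(1) by simp
    ultimately show "y \<in> {y \<in> A. F y = F x}"
      using sat[OF x] by simp
  qed
  moreover have "inj_on (madd X Y x) {z. arr z X Y \<and> F z = mzero X' Y'}"
  proof (rule inj_onI)
    fix y z assume "y \<in> {z. arr z X Y \<and> F z = mzero X' Y'}" "z \<in> {z. arr z X Y \<and> F z = mzero X' Y'}"
      and eq: "madd X Y x y = madd X Y x z"
    then have y: "arr y X Y" and z: "arr z X Y"
      by auto
    have "madd X Y (madd X Y y x) (mneg X Y x) = madd X Y (madd X Y z x) (mneg X Y x)"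
      by (simp only: plus_comm[OF y ax] plus_comm[OF z ax] eq)
    then show "y = z"
      by (simp only: plus_diff_cancel(1)[OF y ax] plus_diff_cancel(1)[OF z ax])
  qed
  ultimately show "card {y \<in> A. F y = F x} = card {z. arr z X Y \<and> F z = mzero X' Y'}"
    by (simp add: card_image)
qed

end

lemma (in vectorspace) finite_carrier_if_fin_dim:
  assumes "fin_dim" "finite (carrier K)"
  shows "finite (carrier V)"
proof -
  obtain A where A: "finite A" "A \<subseteq> carrier V" "gen_set A"
    using assms(1) unfolding fin_dim_def by blast
  have "carrier V \<subseteq> (\<lambda>a. lincomb a A) ` (A \<rightarrow>\<^sub>E carrier K)"
  proof
    fix v assume "v \<in> carrier V"
    then obtain a where a: "a \<in> A \<rightarrow> carrier K" "v = lincomb a A"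
      using finite_in_span[OF A(1,2)] A(3) by auto
    have "lincomb (restrict a A) A = lincomb a A"
      unfolding lincomb_def using a(1) A(2)
      by (intro finsum_cong') (auto intro!: smult_closed)
    then show "v \<in> (\<lambda>a. lincomb a A) ` (A \<rightarrow>\<^sub>E carrier K)"
      using a by (intro image_eqI[of _ _ "restrict a A"]) auto
  qed
  then show ?thesis
    using finite_PiE[OF A(1)] assms(2) by (meson finite_imageI finite_subset)
qed

lemma (in vectorspace) carrier_if_dim_zero:
  assumes "fin_dim" "dim = 0"
  shows "carrier V = {\<zero>\<^bsub>V\<^esub>}"
proof -
  obtain A where A: "finite A" "basis A"
    using finite_basis_exists[OF assms(1)] by blast
  then have "A = {}"
    using dim_basis[OF A] assms(2) by simp
  moreover have "span {} = {\<zero>\<^bsub>V\<^esub>}"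
    unfolding span_def lincomb_def by auto
  ultimately show ?thesis
    using A(2) unfolding basis_def by simp
qed

context left_homologically_finite_tri_cat
begin

lemma finite_Hom: "X \<in> Ob C \<Longrightarrow> Y \<in> Ob C \<Longrightarrow> finite (Hom C X Y)"
  using vectorspace.finite_carrier_if_fin_dim[OF Mor_vectorspace Hom_fin_dim base_finite] .

lemma shO_iter_Ob: "X \<in> Ob C \<Longrightarrow> (shO C ^^ i) X \<in> Ob C"
  by (induction i) (simp_all add: sh_Ob)

text \<open>Dimensions are natural numbers, so a summable sequence of them is eventually below 1 and
  hence zero.\<close>

lemma eventually_Hom_trivial:
  assumes X: "X \<in> Ob C" and Y: "Y \<in> Ob C"
  shows "\<forall>\<^sub>F i in sequentially. card (Hom C ((shO C ^^ i) X) Y) = 1"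
proof -
  have "(\<lambda>i. real (vectorspace.dim K (Mor C ((shO C ^^ i) X) Y))) \<longlonglongrightarrow> 0"
    by (rule summable_LIMSEQ_zero[OF left_finite[OF X Y]])
  then have "\<forall>\<^sub>F i in sequentially. real (vectorspace.dim K (Mor C ((shO C ^^ i) X) Y)) < 1"
    by (rule order_tendstoD) simp
  then show ?thesis
  proof (rule eventually_mono)
    fix i assume "real (vectorspace.dim K (Mor C ((shO C ^^ i) X) Y)) < 1"
    then have "vectorspace.dim K (Mor C ((shO C ^^ i) X) Y) = 0"
      by simp
    then have "Hom C ((shO C ^^ i) X) Y = {mzero ((shO C ^^ i) X) Y}"
      by (rule vectorspace.carrier_if_dim_zero[OF Mor_vectorspace[OF shO_iter_Ob[OF X] Y]
            Hom_fin_dim[OF shO_iter_Ob[OF X] Y]])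
    then show "card (Hom C ((shO C ^^ i) X) Y) = 1"
      by simp
  qed
qed

section \<open>Truncated alternating products\<close>

definition hcard where
  "hcard X Y = rat_of_nat (card (Hom C X Y))"

text \<open>The product after \<open>n\<close> factors, which admits induction on \<open>n\<close>.
  It agrees with \<open>brace\<close> once all later Hom spaces are trivial.\<close>

definition brace_upto where
  "brace_upto n X Y = (\<Prod>i = 1..n. hcard ((shO C ^^ i) X) Y powi ((-1) ^ i))"

lemma hcard_nonzero:
  assumes X: "X \<in> Ob C" and Y: "Y \<in> Ob C"
  shows "hcard X Y \<noteq> 0"
  using finite_Hom[OF X Y] arr_Hom[OF arr_mzero[OF X Y]] by (auto simp: hcard_def)

lemma brace_upto_nonzero: "X \<in> Ob C \<Longrightarrow> Y \<in> Ob C \<Longrightarrow> brace_upto n X Y \<noteq> 0"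
  using hcard_nonzero[OF shO_iter_Ob[of X]] by (simp add: brace_upto_def)

lemma brace_upto_0: "brace_upto 0 X Y = 1"
  by (simp add: brace_upto_def)

text \<open>After the factor \<open>i = 1\<close> is split off, the index shift reverses the sign of
  every exponent, so the remaining product is the inverse of the one for
  \<open>X[1]\<close>.\<close>

lemma brace_upto_Suc:
  "brace_upto (Suc n) X Y = 1 / (hcard (shO C X) Y * brace_upto n (shO C X) Y)"
proof -
  let ?f = "\<lambda>i. hcard ((shO C ^^ i) X) Y powi ((-1) ^ i)"
  have "brace_upto (Suc n) X Y = ?f 1 * (\<Prod>i = Suc 1..Suc n. ?f i)"
    unfolding brace_upto_def by (subst prod.atLeast_Suc_atMost) simp_all
  also have "(\<Prod>i = Suc 1..Suc n. ?f i) = (\<Prod>i = 1..n. ?f (Suc i))"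
    by (rule prod.shift_bounds_cl_Suc_ivl)
  also have "\<dots> = (\<Prod>i = 1..n. inverse (hcard ((shO C ^^ i) (shO C X)) Y powi ((-1) ^ i)))"
    by (simp add: funpow_swap1 power_int_minus)
  also have "\<dots> = inverse (brace_upto n (shO C X) Y)"
    unfolding brace_upto_def by (rule prod_inversef[unfolded o_def])
  finally show ?thesis
    by (simp add: power_int_minus divide_inverse)
qed

lemma brace_eq_brace_upto:
  assumes "\<And>i. i > n \<Longrightarrow> card (Hom C ((shO C ^^ i) X) Y) = 1"
  shows "brace C X Y = brace_upto n X Y"
  unfolding brace_def brace_upto_def hcard_def
proof (rule prod.mono_neutral_left)
  show "{i. 0 < i \<and> card (Hom C ((shO C ^^ i) X) Y) \<noteq> 1} \<subseteq> {1..n}"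
  proof
    fix i assume "i \<in> {i. 0 < i \<and> card (Hom C ((shO C ^^ i) X) Y) \<noteq> 1}"
    then have "0 < i" "\<not> i > n"
      using assms[of i] by blast+
    then show "i \<in> {1..n}"
      by simp
  qed
qed auto

section \<open>Orders of images in the long exact Hom sequences\<close>

lemma card_Hom_eq_image_times_kernel:
  assumes F: "\<And>x. arr x X Y \<Longrightarrow> arr (F x) X' Y'"
    and add: "\<And>x y. arr x X Y \<Longrightarrow> arr y X Y \<Longrightarrow> F (madd X Y x y) = madd X' Y' (F x) (F y)"
    and X: "X \<in> Ob C" and Y: "Y \<in> Ob C"
  shows "card (Hom C X Y) = card (F ` Hom C X Y) * card {z. arr z X Y \<and> F z = mzero X' Y'}"
  by (rule card_saturated_eq[OF finite_Hom[OF X Y] _ F add])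
    (simp_all add: Hom_eq_arr[OF X Y])

lemma card_Hom_precomp:
  assumes f: "arr f X Y" and T: "T \<in> Ob C"
  shows "card (Hom C Y T) = card ((\<lambda>x. x \<cdot> f) ` Hom C Y T) * card {z. arr z Y T \<and> z \<cdot> f = mzero X T}"
  by (rule card_Hom_eq_image_times_kernel[OF arr_cmp[OF f] cmp_plus_left[OF f] arr_cod[OF f] T])

lemma card_Hom_postcomp:
  assumes f: "arr f X Y" and T: "T \<in> Ob C"
  shows "card (Hom C T X) = card ((\<lambda>x. f \<cdot> x) ` Hom C T X) * card {z. arr z T X \<and> f \<cdot> z = mzero T Y}"
  by (rule card_Hom_eq_image_times_kernel[OF arr_cmp[OF _ f] cmp_plus_right[OF _ _ f] T arr_dom[OF f]])

lemma kernel_precomp: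
  assumes d: "dist X Y Z u v w" and T: "T \<in> Ob C"
  shows "{z. arr z Z T \<and> z \<cdot> v = mzero Y T} = (\<lambda>x. x \<cdot> w) ` Hom C (shO C X) T"
proof -
  note v = dist_arr(2)[OF d] and w = dist_arr(3)[OF d]
  have "(x \<cdot> w) \<cdot> v = mzero Y T" if "arr x (shO C X) T" for x
    using cmp_assoc_arr[OF v w that] dist_cmp_zero2[OF d] cmp_mzero_right[OF that dist_Ob(2)[OF d]] by simp
  moreover have "\<exists>x. arr x (shO C X) T \<and> z = x \<cdot> w" if "arr z Z T" "z \<cdot> v = mzero Y T" for z
    using dist_exact_con2[OF d that] by metis
  ultimately show ?thesis
    unfolding Hom_eq_arr[OF sh_Ob[OF dist_Ob(1)[OF d]] T] using arr_cmp[OF w] by blast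
qed

lemma kernel_postcomp1:
  assumes d: "dist X Y Z u v w" and T: "T \<in> Ob C"
  shows "{z. arr z T Y \<and> v \<cdot> z = mzero T Z} = (\<lambda>x. u \<cdot> x) ` Hom C T X"
proof -
  note u = dist_arr(1)[OF d] and v = dist_arr(2)[OF d]
  have "v \<cdot> (u \<cdot> x) = mzero T Z" if "arr x T X" for x
    using cmp_assoc_arr[OF that u v] dist_cmp_zero1[OF d] cmp_mzero_left[OF that dist_Ob(3)[OF d]] by simp
  moreover have "\<exists>x. arr x T X \<and> z = u \<cdot> x" if "arr z T Y" "v \<cdot> z = mzero T Z" for z
    using dist_exact_cov1[OF d that] by metis
  ultimately show ?thesis
    unfolding Hom_eq_arr[OF T dist_Ob(1)[OF d]] using arr_cmp[OF _ u] by blast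
qed

lemma kernel_postcomp3:
  assumes d: "dist X Y Z u v w" and T: "T \<in> Ob C"
  shows "{z. arr z T (shO C X) \<and> shM C u \<cdot> z = mzero T (shO C Y)} = (\<lambda>x. w \<cdot> x) ` Hom C T Z"
proof -
  note su = arr_sh[OF dist_arr(1)[OF d]] and w = dist_arr(3)[OF d]
  have "shM C u \<cdot> (w \<cdot> x) = mzero T (shO C Y)" if "arr x T Z" for x
    using cmp_assoc_arr[OF that w su] dist_cmp_zero3[OF d] cmp_mzero_left[OF that arr_cod[OF su]] by simp
  moreover have "\<exists>x. arr x T Z \<and> z = w \<cdot> x"
    if "arr z T (shO C X)" "shM C u \<cdot> z = mzero T (shO C Y)" for z
    using dist_exact_cov3[OF d that] by metis
  ultimately show ?thesis
    unfolding Hom_eq_arr[OF T dist_Ob(3)[OF d]] using arr_cmp[OF _ w] by blast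
qed

text \<open>Connects consecutive degrees: after one shift, the kernel of composition with
  \<open>u\<close> becomes the image of \<open>w\<close> on
  \<open>Hom C (shO C T) Z\<close>.\<close>

lemma card_sh_kernel:
  assumes u: "arr u X Y" and T: "T \<in> Ob C"
  shows "card {z. arr z T X \<and> u \<cdot> z = mzero T Y} =
    card {z. arr z (shO C T) (shO C X) \<and> shM C u \<cdot> z = mzero (shO C T) (shO C Y)}"
    (is "card ?A = card ?B")
proof -
  note X = arr_dom[OF u] and Y = arr_cod[OF u]
  have "shM C ` ?A = ?B"
  proof (intro equalityI subsetI)
    fix y assume "y \<in> shM C ` ?A"
    then obtain z where z: "arr z T X" "u \<cdot> z = mzero T Y" "y = shM C z"
      by blast
    then show "y \<in> ?B"
      using arr_sh[OF z(1)] sh_cmp_arr[OF z(1) u] sh_mzero[OF T Y] by simp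
  next
    fix y assume "y \<in> ?B"
    then have y: "arr y (shO C T) (shO C X)" "shM C u \<cdot> y = mzero (shO C T) (shO C Y)"
      by auto
    obtain z where z: "arr z T X" "shM C z = y"
      using sh_full[OF T X y(1)] .
    have "u \<cdot> z = mzero T Y"
      by (rule sh_inj[OF arr_cmp[OF z(1) u] arr_mzero[OF T Y]])
        (simp only: sh_cmp_arr[OF z(1) u] z(2) y(2) sh_mzero[OF T Y])
    then show "y \<in> shM C ` ?A"
      using z by blast
  qed
  moreover have "inj_on (shM C) ?A"
    by (rule inj_onI) (use sh_inj in blast)
  then have "card (shM C ` ?A) = card ?A"
    by (rule card_image)
  ultimately show ?thesis
    by (simp only:)
qed

text \<open>Each of the three Hom orders is image times kernel, and each kernel is the image of the
  next map; both sides become the product of the same four image orders.\<close>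

lemma card_image_precomp_shift:
  assumes d: "dist X Y Z u v w" and d': "dist (shO C X) (shO C Y) (shO C Z) u' v' w'"
    and r: "dist Y Z (shO C X) v w u'" "dist Z (shO C X) (shO C Y) w u' v'"
    and T: "T \<in> Ob C"
  shows "card ((\<lambda>x. x \<cdot> w) ` Hom C (shO C X) T) * card ((\<lambda>x. x \<cdot> w') ` Hom C (shO C (shO C X)) T) *
    card (Hom C (shO C Y) T) = card (Hom C (shO C X) T) * card (Hom C (shO C Z) T)"
  unfolding card_Hom_precomp[OF dist_arr(3)[OF d] T] kernel_precomp[OF r(1) T]
    card_Hom_precomp[OF dist_arr(1)[OF d'] T] kernel_precomp[OF r(2) T]
    card_Hom_precomp[OF dist_arr(2)[OF d'] T] kernel_precomp[OF d' T]
  by (simp only: mult_ac)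

text \<open>The same count, but the triangle stays fixed and \<open>T\<close> is shifted.\<close>

lemma card_image_postcomp_shift:
  assumes d: "dist X Y Z u v w" and T: "T \<in> Ob C"
  shows "card ((\<lambda>x. w \<cdot> x) ` Hom C T Z) * card ((\<lambda>x. w \<cdot> x) ` Hom C (shO C T) Z) * card (Hom C T Y) =
    card (Hom C T X) * card (Hom C T Z)"
  unfolding card_Hom_postcomp[OF dist_arr(3)[OF d] T] kernel_postcomp1[OF dist_rotate[OF d] T]
    card_Hom_postcomp[OF dist_arr(2)[OF d] T] kernel_postcomp1[OF d T]
    card_Hom_postcomp[OF dist_arr(1)[OF d] T] card_sh_kernel[OF dist_arr(1)[OF d] T]
    kernel_postcomp3[OF d sh_Ob[OF T]]
  by (simp only: mult_ac)

text \<open>Three rotations shift the triangle. The signs they introduce are hidden in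
  \<open>u'\<close>, \<open>v'\<close>, \<open>w'\<close>; the counting uses only that consecutive
  triangles share these maps.\<close>

lemma dist_shift:
  assumes d: "dist X Y Z u v w"
  obtains u' v' w' where "dist Y Z (shO C X) v w u'" "dist Z (shO C X) (shO C Y) w u' v'"
    "dist (shO C X) (shO C Y) (shO C Z) u' v' w'"
  using that dist_rotate[OF d] dist_rotate[OF dist_rotate[OF d]] dist_rotate[OF dist_rotate[OF dist_rotate[OF d]]]
  by blast

text \<open>Arithmetic of the recursion: \<open>r\<close> and \<open>r'\<close> are consecutive
  image orders, \<open>x\<close>, \<open>y\<close>, \<open>z\<close> are Hom orders, and
  \<open>bx\<close>, \<open>b'\<close>, \<open>bz\<close> are truncated products one shift later.
  The conclusion has the shape produced by \<open>brace_upto_Suc\<close>.\<close>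

lemma quotient_step:
  fixes r r' x y z bx b' bz :: rat
  assumes "r * r' * y = x * z" "r' = b' / (bx * bz)"
    and "y \<noteq> 0" "bx \<noteq> 0" "b' \<noteq> 0" "bz \<noteq> 0"
  shows "r = (1 / (y * b')) / ((1 / (x * bx)) * (1 / (z * bz)))"
proof -
  have "r * (b' * y) = x * z * (bx * bz)"
    using assms by (simp add: field_simps)
  then show ?thesis
    using assms by (simp add: field_simps)
qed

text \<open>Each induction step passes to the shifted triangle, so the recursion ends at maps out of
  \<open>X[n+1]\<close>. A single trivial Hom space there therefore suffices, even if those for
  \<open>Y\<close> and \<open>Z\<close> have not yet become trivial.\<close>

lemma card_image_precomp:
  assumes "dist X Y Z u v w" and T: "T \<in> Ob C" and "card (Hom C ((shO C ^^ Suc n) X) T) = 1"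
  shows "rat_of_nat (card ((\<lambda>x. x \<cdot> w) ` Hom C (shO C X) T)) =
    brace_upto n Y T / (brace_upto n X T * brace_upto n Z T)"
  using assms(1,3)
proof (induction n arbitrary: X Y Z u v w)
  case 0
  then have "card (Hom C (shO C X) T) = 1"
    by simp
  then obtain x where "Hom C (shO C X) T = {x}"
    using card_1_singletonE by blast
  then show ?case
    by (simp add: brace_upto_0)
next
  case (Suc n)
  note d = Suc.prems(1)
  note O = sh_Ob[OF dist_Ob(1)[OF d]] sh_Ob[OF dist_Ob(2)[OF d]] sh_Ob[OF dist_Ob(3)[OF d]]
  obtain u' v' w' where d': "dist Y Z (shO C X) v w u'" "dist Z (shO C X) (shO C Y) w u' v'"
    "dist (shO C X) (shO C Y) (shO C Z) u' v' w'"
    using dist_shift[OF d] .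
  have "card (Hom C ((shO C ^^ Suc n) (shO C X)) T) = 1"
    using Suc.prems(2) by (simp add: funpow_swap1)
  note IH = Suc.IH[OF d'(3) this]
  show ?case
    unfolding brace_upto_Suc
    by (rule quotient_step[OF _ IH hcard_nonzero[OF O(2) T] brace_upto_nonzero[OF O(1) T]
          brace_upto_nonzero[OF O(2) T] brace_upto_nonzero[OF O(3) T]])
      (simp only: hcard_def of_nat_mult[symmetric] card_image_precomp_shift[OF d d'(3,1,2) T])
qed

lemma card_image_postcomp:
  assumes d: "dist X Y Z u v w" and "T \<in> Ob C" and "card (Hom C ((shO C ^^ Suc n) T) Z) = 1"
  shows "rat_of_nat (card ((\<lambda>x. w \<cdot> x) ` Hom C (shO C T) Z)) =
    brace_upto n T Y / (brace_upto n T X * brace_upto n T Z)"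
  using assms(2,3)
proof (induction n arbitrary: T)
  case 0
  then have "card (Hom C (shO C T) Z) = 1"
    by simp
  then obtain x where "Hom C (shO C T) Z = {x}"
    using card_1_singletonE by blast
  then show ?case
    by (simp add: brace_upto_0)
next
  case (Suc n)
  note O = dist_Ob[OF d]
  note T = sh_Ob[OF Suc.prems(1)]
  have "card (Hom C ((shO C ^^ Suc n) (shO C T)) Z) = 1"
    using Suc.prems(2) by (simp add: funpow_swap1)
  note IH = Suc.IH[OF T this]
  show ?case
    unfolding brace_upto_Suc
    by (rule quotient_step[OF _ IH hcard_nonzero[OF T O(2)] brace_upto_nonzero[OF T O(1)]
          brace_upto_nonzero[OF T O(2)] brace_upto_nonzero[OF T O(3)]])
      (simp only: hcard_def of_nat_mult[symmetric] card_image_postcomp_shift[OF d T])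
qed

lemma eventually_brace_eq_brace_upto:
  assumes "X \<in> Ob C" "Y \<in> Ob C"
  shows "\<forall>\<^sub>F n in sequentially. brace C X Y = brace_upto n X Y \<and> card (Hom C ((shO C ^^ Suc n) X) Y) = 1"
proof -
  obtain N where N: "\<And>i. i \<ge> N \<Longrightarrow> card (Hom C ((shO C ^^ i) X) Y) = 1"
    using eventually_Hom_trivial[OF assms] unfolding eventually_sequentially by blast
  show ?thesis
    unfolding eventually_sequentially
  proof (intro exI allI impI conjI)
    fix n assume n: "N \<le> n"
    show "brace C X Y = brace_upto n X Y"
      by (rule brace_eq_brace_upto) (use N n in simp)
    show "card (Hom C ((shO C ^^ Suc n) X) Y) = 1"
      by (rule N) (use n in simp)
  qed
qed

lemma card_image_precomp_brace:
  assumes d: "dist X Y Z u v w" and T: "T \<in> Ob C"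
  shows "rat_of_nat (card ((\<lambda>x. x \<cdot> w) ` Hom C (shO C X) T)) = brace C Y T / (brace C X T * brace C Z T)"
proof -
  note e = eventually_brace_eq_brace_upto[OF _ T]
  \<comment> \<open>The claim is independent of \<open>n\<close>, so it is enough that it holds for
    large \<open>n\<close>, where all three truncations are exact.\<close>
  have "\<forall>\<^sub>F n in sequentially. rat_of_nat (card ((\<lambda>x. x \<cdot> w) ` Hom C (shO C X) T)) =
      brace C Y T / (brace C X T * brace C Z T)"
    using e[OF dist_Ob(1)[OF d]] e[OF dist_Ob(2)[OF d]] e[OF dist_Ob(3)[OF d]]
    by eventually_elim (simp only: card_image_precomp[OF d T])
  then show ?thesis
    by simp
qed

lemma card_image_postcomp_brace:
  assumes d: "dist X Y Z u v w" and T: "T \<in> Ob C"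
  shows "rat_of_nat (card ((\<lambda>x. w \<cdot> x) ` Hom C (shO C T) Z)) = brace C T Y / (brace C T X * brace C T Z)"
proof -
  note e = eventually_brace_eq_brace_upto[OF T]
  have "\<forall>\<^sub>F n in sequentially. rat_of_nat (card ((\<lambda>x. w \<cdot> x) ` Hom C (shO C T) Z)) =
      brace C T Y / (brace C T X * brace C T Z)"
    using e[OF dist_Ob(1)[OF d]] e[OF dist_Ob(2)[OF d]] e[OF dist_Ob(3)[OF d]]
    by eventually_elim (simp only: card_image_postcomp[OF d T])
  then show ?thesis
    by simp
qed

section \<open>Orbit-stabilizer counts for automorphisms\<close>

lemma finite_Aut: "L \<in> Ob C \<Longrightarrow> finite {a. iso a L L}"
  by (rule finite_subset[OF _ finite_Hom[of L L]]) (auto dest: iso_arr arr_Hom)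

text \<open>The fibres of \<open>a -> a \<cdot> g\<close> are the left cosets of the stabilizer;
  translation by \<open>a\<close> and by its inverse gives the bijection.\<close>

lemma card_Aut_orbit_post:
  assumes g: "arr g S L"
  shows "card {a. iso a L L} = card {a \<cdot> g | a. iso a L L} * card {a. iso a L L \<and> a \<cdot> g = g}"
proof -
  note L = arr_cod[OF g]
  have "card {b \<in> {a. iso a L L}. b \<cdot> g = a \<cdot> g} = card {a. iso a L L \<and> a \<cdot> g = g}"
    if "a \<in> {a. iso a L L}" for a
  proof -
    have a: "iso a L L" using that by simp
    note aa = iso_arr[OF a]
    obtain a' where a': "iso a' L L" "a' \<cdot> a = idm C L" "a \<cdot> a' = idm C L"
      using iso_inverse[OF a] .
    note aa' = iso_arr[OF a'(1)]
    have "bij_betw (\<lambda>s. a \<cdot> s) {s. iso s L L \<and> s \<cdot> g = g} {b \<in> {a. iso a L L}. b \<cdot> g = a \<cdot> g}"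
    proof (rule bij_betw_byWitness[where f' = "\<lambda>b. a' \<cdot> b"])
      show "\<forall>s \<in> {s. iso s L L \<and> s \<cdot> g = g}. a' \<cdot> (a \<cdot> s) = s"
        using cmp_cancel_left[OF _ aa aa' a'(2)] iso_arr by blast
      show "\<forall>b \<in> {b \<in> {a. iso a L L}. b \<cdot> g = a \<cdot> g}. a \<cdot> (a' \<cdot> b) = b"
        using cmp_cancel_left[OF _ aa' aa a'(3)] iso_arr by blast
      show "(\<lambda>s. a \<cdot> s) ` {s. iso s L L \<and> s \<cdot> g = g} \<subseteq> {b \<in> {a. iso a L L}. b \<cdot> g = a \<cdot> g}"
        using iso_cmp[OF _ a] cmp_assoc_arr[OF g _ aa] iso_arr by auto
      show "(\<lambda>b. a' \<cdot> b) ` {b \<in> {a. iso a L L}. b \<cdot> g = a \<cdot> g} \<subseteq> {s. iso s L L \<and> s \<cdot> g = g}"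
        using iso_cmp[OF _ a'(1)] cmp_assoc_arr[OF g _ aa'] cmp_cancel_left[OF g aa aa' a'(2)] iso_arr by auto
    qed
    then show ?thesis
      by (rule bij_betw_same_card[THEN sym])
  qed
  then show ?thesis
    using card_eq_card_image_times_fibre[OF finite_Aut[OF L], of "\<lambda>a. a \<cdot> g"]
    by (simp add: setcompr_eq_image)
qed

lemma card_Aut_orbit_pre:
  assumes g: "arr g L S"
  shows "card {a. iso a L L} = card {g \<cdot> a | a. iso a L L} * card {a. iso a L L \<and> g \<cdot> a = g}"
proof -
  note L = arr_dom[OF g]
  have "card {b \<in> {a. iso a L L}. g \<cdot> b = g \<cdot> a} = card {a. iso a L L \<and> g \<cdot> a = g}"
    if "a \<in> {a. iso a L L}" for a
  proof -
    have a: "iso a L L" using that by simp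
    note aa = iso_arr[OF a]
    obtain a' where a': "iso a' L L" "a' \<cdot> a = idm C L" "a \<cdot> a' = idm C L"
      using iso_inverse[OF a] .
    note aa' = iso_arr[OF a'(1)]
    have c1: "(s \<cdot> a) \<cdot> a' = s" if "arr s L T" for s T
      using cmp_assoc_arr[OF aa' aa that] a'(3) cmp_idr[OF that] by simp
    have c2: "(s \<cdot> a') \<cdot> a = s" if "arr s L T" for s T
      using cmp_assoc_arr[OF aa aa' that] a'(2) cmp_idr[OF that] by simp
    have "bij_betw (\<lambda>s. s \<cdot> a) {s. iso s L L \<and> g \<cdot> s = g} {b \<in> {a. iso a L L}. g \<cdot> b = g \<cdot> a}"
    proof (rule bij_betw_byWitness[where f' = "\<lambda>b. b \<cdot> a'"])
      show "\<forall>s \<in> {s. iso s L L \<and> g \<cdot> s = g}. (s \<cdot> a) \<cdot> a' = s"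
        using c1 iso_arr by blast
      show "\<forall>b \<in> {b \<in> {a. iso a L L}. g \<cdot> b = g \<cdot> a}. (b \<cdot> a') \<cdot> a = b"
        using c2 iso_arr by blast
      show "(\<lambda>s. s \<cdot> a) ` {s. iso s L L \<and> g \<cdot> s = g} \<subseteq> {b \<in> {a. iso a L L}. g \<cdot> b = g \<cdot> a}"
        using iso_cmp[OF a] cmp_assoc_arr[OF aa _ g, symmetric] iso_arr by auto
      show "(\<lambda>b. b \<cdot> a') ` {b \<in> {a. iso a L L}. g \<cdot> b = g \<cdot> a} \<subseteq> {s. iso s L L \<and> g \<cdot> s = g}"
        using iso_cmp[OF a'(1)] cmp_assoc_arr[OF aa' _ g, symmetric] c1[OF g] iso_arr by auto
    qed
    then show ?thesis
      by (rule bij_betw_same_card[THEN sym])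
  qed
  then show ?thesis
    using card_eq_card_image_times_fibre[OF finite_Aut[OF L], of "\<lambda>a. g \<cdot> a"]
    by (simp add: setcompr_eq_image)
qed

end

section \<open>The counting formula\<close>

context left_homologically_finite_tri_cat
begin

text \<open>A cross-multiplied ratio: the index set \<open>?U\<close> and the whole of
  \<open>Hom C (shO C L') L\<close> have the same kernel factor over their images under
  \<open>c -> ch\<close>, and the image of \<open>?U\<close> has the order of the
  stabilizer.\<close>

lemma card_stabilizer_post:
  assumes d: "dist L' S L g' g h"
  shows "card {a. iso a L L \<and> a \<cdot> g = g} * card (Hom C (shO C L') L) =
    card {c. arr c (shO C L') L \<and> iso (madd L L (idm C L) (c \<cdot> h)) L L} *
    card ((\<lambda>x. x \<cdot> h) ` Hom C (shO C L') L)"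
    (is "card ?S * _ = card ?U * _")
proof -
  note h = dist_arr(3)[OF d] and L = dist_Ob(3)[OF d] and P = sh_Ob[OF dist_Ob(1)[OF d]]
  have "card ?S = card ((\<lambda>c. c \<cdot> h) ` ?U)"
    unfolding stabilizer_post_eq[OF d]
    by (rule card_image[OF inj_on_one_plus[OF L]]) (use arr_cmp[OF h] in blast)
  moreover have "card ?U = card ((\<lambda>c. c \<cdot> h) ` ?U) * card {z. arr z (shO C L') L \<and> z \<cdot> h = mzero L L}"
  proof (rule card_saturated_eq[where F = "\<lambda>c. c \<cdot> h", OF _ _ arr_cmp[OF h] cmp_plus_left[OF h]])
    show "finite ?U"
      by (rule finite_subset[OF _ finite_Hom[OF P L]]) (auto dest: arr_Hom)
  qed auto
  ultimately show ?thesis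
    unfolding card_Hom_precomp[OF h L] by (simp only: mult_ac)
qed

lemma card_stabilizer_pre:
  assumes d: "dist L' S L g' g h"
  shows "card {a. iso a L' L' \<and> g' \<cdot> a = g'} * card (Hom C (shO C L') L) =
    card {c. arr c (shO C L') L \<and> iso (madd L L (idm C L) (c \<cdot> h)) L L} *
    card ((\<lambda>x. h \<cdot> x) ` Hom C (shO C L') L)"
    (is "card ?S * _ = card ?U * _")
proof -
  note h = dist_arr(3)[OF d] and L = dist_Ob(3)[OF d] and P = sh_Ob[OF dist_Ob(1)[OF d]]
  let ?P = "shO C L'"
  have "inj_on (shM C) ?S"
    by (rule inj_onI) (use sh_inj iso_arr in blast)
  then have "card ?S = card (shM C ` ?S)"
    by (rule card_image[symmetric])
  also have "\<dots> = card ((\<lambda>c. h \<cdot> c) ` ?U)"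
    unfolding sh_stabilizer_pre_eq[OF d]
    by (rule card_image[OF inj_on_one_plus[OF P]]) (use arr_cmp[OF _ h] in blast)
  finally have "card ?S = card ((\<lambda>c. h \<cdot> c) ` ?U)" .
  moreover have "card ?U = card ((\<lambda>c. h \<cdot> c) ` ?U) * card {z. arr z ?P L \<and> h \<cdot> z = mzero ?P ?P}"
  proof (rule card_saturated_eq[where F = "\<lambda>c. h \<cdot> c", OF _ _ arr_cmp[OF _ h] cmp_plus_right[OF _ _ h]])
    show "finite ?U"
      by (rule finite_subset[OF _ finite_Hom[OF P L]]) (auto dest: arr_Hom)
    \<comment> \<open>Membership in \<open>?U\<close> is stated through \<open>ch\<close>. Passing
      to \<open>hc\<close> for \<open>x\<close> and back for \<open>y\<close> shows that it depends
      on \<open>hc\<close> alone.\<close>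
    fix x y assume x: "x \<in> ?U" and y: "arr y ?P L" and eq: "h \<cdot> y = h \<cdot> x"
    then have ax: "arr x ?P L" and ix: "iso (madd L L (idm C L) (x \<cdot> h)) L L"
      by auto
    have "iso (madd ?P ?P (idm C ?P) (h \<cdot> y)) ?P ?P"
      unfolding eq by (rule iso_one_plus_swap[OF h ax ix])
    then show "y \<in> ?U"
      using iso_one_plus_swap[OF y h] y by simp
  qed auto
  ultimately show ?thesis
    unfolding card_Hom_postcomp[OF h P] by (simp only: mult_ac)
qed

text \<open>Both sides equal |Hom(L'[1], L)| / |U|, where U is the set of \<open>c\<close> with
  \<open>1 + ch\<close> invertible.\<close>

lemma weighted_orbit_eq:
  assumes d: "dist L' S L g' g h"
  shows "rat_of_nat (card {a \<cdot> g | a. iso a L L}) *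
      (brace C S L / (brace C L' L * brace C L L) / rat_of_nat (card {a. iso a L L})) =
    rat_of_nat (card {g' \<cdot> a | a. iso a L' L'}) *
      (brace C L' S / (brace C L' L * brace C L' L') / rat_of_nat (card {a. iso a L' L'}))"
proof -
  note g' = dist_arr(1)[OF d] and g = dist_arr(2)[OF d]
  note L' = dist_Ob(1)[OF d] and L = dist_Ob(3)[OF d]
  define N where "N = card (Hom C (shO C L') L)"
  define u where "u = card {c. arr c (shO C L') L \<and> iso (madd L L (idm C L) (c \<cdot> h)) L L}"
  have N: "N > 0"
    using finite_Hom[OF sh_Ob[OF L'] L] arr_Hom[OF arr_mzero[OF sh_Ob[OF L'] L]]
    by (auto simp: N_def card_gt_0_iff)
  have A: "card {a. iso a L L} > 0" "card {a. iso a L' L'} > 0"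
    using finite_Aut[OF L] finite_Aut[OF L'] iso_id[OF L] iso_id[OF L'] by (auto simp: card_gt_0_iff)
  \<comment> \<open>Here \<open>n\<close> is the orbit size, \<open>s\<close> the stabilizer order,
    \<open>A\<close> the order of the automorphism group and \<open>i\<close> the order of the full
    image. Cancelling \<open>n\<close> leaves \<open>i / s\<close>, which the stabilizer count turns
    into \<open>N / u\<close>.\<close>
  have quot: "rat_of_nat n * (rat_of_nat i / rat_of_nat A) = rat_of_nat N / rat_of_nat u"
    if "A > 0" "A = n * s" "s * N = u * i" for n i A s
  proof -
    have s: "s > 0" "n > 0"
      using that(1,2) by (auto intro: ccontr)
    then have "u * i > 0"
      using N that(3) by (metis mult_pos_pos)
    then have u: "u > 0"
      by simp
    have "rat_of_nat s * rat_of_nat N = rat_of_nat u * rat_of_nat i"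
      using that(3) by (metis of_nat_mult)
    then show ?thesis
      using s u unfolding that(2) by (simp add: field_simps)
  qed
  show ?thesis
    unfolding card_image_precomp_brace[OF d L, symmetric]
      card_image_postcomp_brace[OF d L', symmetric, unfolded mult.commute[of "brace C L' L'"]]
      quot[OF A(1) card_Aut_orbit_post[OF g] card_stabilizer_post[OF d, folded N_def u_def]]
      quot[OF A(2) card_Aut_orbit_pre[OF g'] card_stabilizer_pre[OF d, folded N_def u_def]]
    by (rule refl)
qed

end

theorem mainTheorem3:
  fixes K :: "('k, 'q) ring_scheme" and C :: "('k, 'o, 'm, 'z) tri_cat_scheme"
    and X Y Z M L L' S :: 'o and iM iX pM pX :: 'm
  assumes "left_homologically_finite_tri_cat K C"
    and "X \<in> Ob C" and "Y \<in> Ob C" and "Z \<in> Ob C"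
    and "M \<in> Ob C" and "L \<in> Ob C" and "L' \<in> Ob C"
    and "is_biproduct C M X S iM iX pM pX"
  shows
    "let H = Hom_from_sum C M X S pM pX L Y Z L';
         H' = Hom_to_sum C M X S iM iX L' Y Z L
     in (\<exists>\<phi>. bij_betw \<phi> (orbits (Aut C L) H (post_act C)) (orbits (Aut C L') H' (pre_act C L')) \<and>
              (\<forall>g \<in> H. \<forall>g' \<in> H'.
                 \<phi> (orbit (Aut C L) (post_act C) g) = orbit (Aut C L') (pre_act C L') g' \<longleftrightarrow>
                 (\<exists>h. distinguished C L' S L g' g h))) \<and>
        rat_of_nat (card H) / rat_of_nat (card (carrier (Aut C L))) *
          (brace C S L / (brace C L' L * brace C L L)) =
        rat_of_nat (card H') / rat_of_nat (card (carrier (Aut C L'))) *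
          (brace C L' S / (brace C L' L * brace C L' L'))"
proof -
  interpret left_homologically_finite_tri_cat K C
    by fact
  note X = assms(2) and Y = assms(3) and Z = assms(4) and M = assms(5) and L = assms(6) and L' = assms(7)
    and b = assms(8)
  note S = arr_cod[OF biproduct_arr(1)[OF b M X]]
  define H where "H = Hom_from_sum C M X S pM pX L Y Z L'"
  define H' where "H' = Hom_to_sum C M X S iM iX L' Y Z L"
  define orb where "orb g = {cmp C a g | a. iso a L L}" for g
  define orb' where "orb' g = {cmp C g a | a. iso a L' L'}" for g
  have H: "arr g S L" if "g \<in> H" for g
    using that mem_Hom_from_sum_iff[OF b M X L] unfolding H_def by blast
  have H': "arr g L' S" if "g \<in> H'" for g
    using that mem_Hom_to_sum_iff[OF b M X L' Z] unfolding H'_def by blast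
  have mem: "g \<in> H \<longleftrightarrow> g' \<in> H'" if "dist L' S L g' g h" for g g' h
    unfolding H_def H'_def by (rule mem_Hom_from_sum_iff_mem_Hom_to_sum[OF b M X Y Z that])
  have total: "\<exists>g' \<in> H'. \<exists>h. dist L' S L g' g h" if "g \<in> H" for g
    using Hom_from_sum_ex_dist[OF b M X Y Z L L'] that unfolding H_def H'_def by blast
  have total': "\<exists>g \<in> H. \<exists>h. dist L' S L g' g h" if "g' \<in> H'" for g'
    using Hom_to_sum_ex_dist[OF b M X Y Z L L'] that unfolding H_def H'_def by blast
  have refl: "g \<in> orb g" if "g \<in> H" for g
    unfolding orb_def by (rule orbit_post_act_refl[OF H[OF that]])
  have refl': "g \<in> orb' g" if "g \<in> H'" for g
    unfolding orb'_def by (rule orbit_pre_act_refl[OF H'[OF that]])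
  have orb_iff: "orb g1 = orb g2 \<longleftrightarrow> (\<exists>a. iso a L L \<and> g2 = cmp C a g1)" if "g1 \<in> H" "g2 \<in> H" for g1 g2
    unfolding orb_def by (rule orbit_post_act_eq_iff[OF H[OF that(1)] H[OF that(2)]])
  have orb'_iff: "orb' g1 = orb' g2 \<longleftrightarrow> (\<exists>a. iso a L' L' \<and> g1 = cmp C g2 a)" if "g1 \<in> H'" "g2 \<in> H'" for g1 g2
    unfolding orb'_def by (rule orbit_pre_act_eq_iff[OF H'[OF that(1)] H'[OF that(2)]])
  \<comment> \<open>Invariance is seen on the other side of the triangle: \<open>g\<close> and its
    translate fit into triangles with the same first map \<open>g'\<close>, and membership of either
    is equivalent to \<open>g' \<in> H'\<close>.\<close>
  have sub: "orb g \<subseteq> H" if g: "g \<in> H" for g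
  proof
    fix k assume "k \<in> orb g"
    then obtain a where a: "iso a L L" "k = cmp C a g"
      unfolding orb_def by blast
    obtain g' h where d: "dist L' S L g' g h"
      using total[OF g] by blast
    obtain h' where "dist L' S L g' k h'"
      using dist_postcompose_iso[OF d a(1)] a(2) by blast
    then show "k \<in> H"
      using mem[OF d] mem g by blast
  qed
  have sub': "orb' g' \<subseteq> H'" if g': "g' \<in> H'" for g'
  proof
    fix k assume "k \<in> orb' g'"
    then obtain a where a: "iso a L' L'" "k = cmp C g' a"
      unfolding orb'_def by blast
    obtain g h where d: "dist L' S L g' g h"
      using total'[OF g'] by blast
    obtain h' where "dist L' S L k g h'"
      using dist_precompose_iso[OF d a(1)] a(2) by blast
    then show "k \<in> H'"
      using mem[OF d] mem g' by blast
  qed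
  have eq: "orb k = orb g" if "g \<in> H" "k \<in> orb g" for g k
    using orb_iff[OF that(1), of k] sub[OF that(1)] that(2) unfolding orb_def by blast
  have eq': "orb' k = orb' g" if "g \<in> H'" "k \<in> orb' g" for g k
    using orb'_iff[OF _ that(1), of k] sub'[OF that(1)] that(2) unfolding orb'_def by blast
  have fin: "finite H"
    by (rule finite_subset[OF _ finite_Hom[OF S L]]) (use H arr_Hom in blast)
  have fin': "finite H'"
    by (rule finite_subset[OF _ finite_Hom[OF L' S]]) (use H' arr_Hom in blast)
  have compat: "orb g1 = orb g2 \<longleftrightarrow> orb' g1' = orb' g2'"
    if "g1 \<in> H" "g2 \<in> H" "g1' \<in> H'" "g2' \<in> H'" "\<exists>h. dist L' S L g1' g1 h" "\<exists>h. dist L' S L g2' g2 h"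
    for g1 g2 g1' g2'
    using that(5,6) dist_orbit_compat orb_iff[OF that(1,2)] orb'_iff[OF that(3,4)] by blast
  \<comment> \<open>Changing \<open>g1'\<close> by an automorphism of \<open>L'\<close> keeps
    \<open>g\<close> as second map; only the connecting map \<open>h\<close> has to be
    adjusted.\<close>
  have inv: "\<exists>h. dist L' S L g2' g h"
    if "g \<in> H" "g1' \<in> H'" "g2' \<in> H'" "\<exists>h. dist L' S L g1' g h" "orb' g1' = orb' g2'" for g g1' g2'
    using that(4,5) dist_precompose_iso orb'_iff[OF that(3,2)] by blast
  have "\<exists>\<phi>. bij_betw \<phi> (orb ` H) (orb' ` H') \<and>
      (\<forall>g \<in> H. \<forall>g' \<in> H'. \<phi> (orb g) = orb' g' \<longleftrightarrow> (\<exists>h. dist L' S L g' g h))"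
    by (rule orbit_correspondence) (fact total total' compat inv)+
  then obtain \<phi> where \<phi>: "bij_betw \<phi> (orb ` H) (orb' ` H')"
    and \<phi>_iff: "\<forall>g \<in> H. \<forall>g' \<in> H'. \<phi> (orb g) = orb' g' \<longleftrightarrow> (\<exists>h. dist L' S L g' g h)"
    by blast
  \<comment> \<open>The weights are the image orders of \<open>c -> ch\<close> and
    \<open>c -> hc\<close>, rewritten by braces, over the orders of the automorphism groups. In this
    form they no longer depend on the chosen triangle, so they can be taken out of the sum over
    orbits.\<close>
  let ?p = "brace C S L / (brace C L' L * brace C L L) / rat_of_nat (card {a. iso a L L})"
  let ?p' = "brace C L' S / (brace C L' L * brace C L' L') / rat_of_nat (card {a. iso a L' L'})"
  have w: "rat_of_nat (card (orb g)) * ?p = rat_of_nat (card (orb' g')) * ?p'"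
    if "g \<in> H" "g' \<in> H'" "\<phi> (orb g) = orb' g'" for g g'
  proof -
    have "\<exists>h. dist L' S L g' g h"
      by (rule iffD1[OF bspec[OF bspec[OF \<phi>_iff that(1)] that(2)] that(3)])
    then obtain h where "dist L' S L g' g h"
      by blast
    then show ?thesis
      unfolding orb_def orb'_def by (rule weighted_orbit_eq)
  qed
  have "rat_of_nat (card H) * ?p = rat_of_nat (card H') * ?p'"
    by (rule weighted_card_eq_if_orbits_correspond[OF fin _ _ _ fin' _ _ _ \<phi>])
      (fact refl sub eq refl' sub' eq' w)+
  then have count: "rat_of_nat (card H) / rat_of_nat (card (carrier (Aut C L))) *
      (brace C S L / (brace C L' L * brace C L L)) =
    rat_of_nat (card H') / rat_of_nat (card (carrier (Aut C L'))) *
      (brace C L' S / (brace C L' L * brace C L' L'))"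
    unfolding carrier_Aut[OF L] carrier_Aut[OF L'] by (simp only: times_divide_eq_left times_divide_eq_right divide_divide_eq_left mult_ac)
  note fold_orb = orbit_post_act[OF L] orbit_pre_act[OF L'] orb_def[symmetric] orb'_def[symmetric]
  have orbits: "orbits (Aut C L) H (post_act C) = orb ` H" "orbits (Aut C L') H' (pre_act C L') = orb' ` H'"
    unfolding orbits_def fold_orb
    by (rule setcompr_eq_image[of orb "\<lambda>g. g \<in> H", unfolded Collect_mem_eq],
        rule setcompr_eq_image[of orb' "\<lambda>g. g \<in> H'", unfolded Collect_mem_eq])
  show ?thesis
    unfolding Let_def H_def[symmetric] H'_def[symmetric] orbits fold_orb
    by (intro conjI exI[of _ \<phi>] \<phi> \<phi>_iff count)
qed

end
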